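(* Let $\mathcal E$ be a small groupoid, $\mathcal B$ a set regarded as a discrete category, and $p:\mathcal E\to\mathcal B$ a functor. For $b\in\mathcal B$ let $\mathcal E_b$ be the fiber groupoid, and define $$\mathcal A:=\operatorname{Lan}_p(y_{\mathcal E}):\mathcal B\to\operatorname{PSh}(\mathcal E)=[\mathcal E^{\mathrm{op}},\mathbf{Set}],$$ the left Kan extension along $p$ of the Yoneda embedding $y_{\mathcal E}:\mathcal E\to\operatorname{PSh}(\mathcal E)$. For $b\in\mathcal B$ and $x\in\mathcal E$, $$\mathcal A(b)(x)\cong\begin{cases}\{*\},&p(x)=b,\\ \varnothing,&p(x)\ne b.\end{cases}$$ Thus $\mathcal A(b)$ is the characteristic presheaf of the full fiber $\mathcal E_b$. It is generally nonrepresentable and does not select an individual realization (that is, an individual object of $\mathcal E_b$). Nevertheless, its category of elements is canonically isomorphic to the fiber groupoid: $$\int_{\mathcal E}\mathcal A(b)\cong\mathcal E_b.$$ Hence the aggregate $\mathcal A(b)$ is one presheaf whose category of elements recovers the objects and automorphisms of the fiber.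
   Context: The objects of $\mathcal E$ are called realizations and the elements of $\mathcal B$ behaviors; $p$ sends a realization to its behavior. The fiber groupoid $\mathcal E_b$ has as objects those $x\in\mathcal E$ with $p(x)=b$, and as morphisms all morphisms of $\mathcal E$ between such objects (each lies over the identity of $b$ because $\mathcal B$ is discrete). The characteristic presheaf of $\mathcal E_b$ is the presheaf on $\mathcal E$ whose value is a singleton at objects of $\mathcal E_b$ and empty at all other objects. The category of elements $\int_{\mathcal E}X$ of a presheaf $X$ on $\mathcal E$ has as objects pairs $(x,\xi)$ with $x\in\mathcal E$ and $\xi\in X(x)$, and as morphisms $(x,\xi)\to(x',\xi')$ the arrows $f:x\to x'$ of $\mathcal E$ with $X(f)(\xi')=\xi$. *)

theory Defs
  imports "HOL-Algebra.Group" "HOL-Library.Equipollence"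
begin

section \<open>Small categories\<close>

text \<open>\<open>Comp C g f\<close> is the composite of \<open>f\<close> followed by \<open>g\<close>; only its values on composable
  arrows of \<open>C\<close> matter.\<close>

record ('o, 'a) cat =
  Ob :: "'o set"
  Arr :: "'a set"
  Dom :: "'a \<Rightarrow> 'o"
  Cod :: "'a \<Rightarrow> 'o"
  Id :: "'o \<Rightarrow> 'a"
  Comp :: "'a \<Rightarrow> 'a \<Rightarrow> 'a"

definition homset :: "('o, 'a) cat \<Rightarrow> 'o \<Rightarrow> 'o \<Rightarrow> 'a set" where
  "homset C x y = {f \<in> Arr C. Dom C f = x \<and> Cod C f = y}"

locale category =
  fixes C :: "('o, 'a) cat"
  assumes Dom_Ob: "f \<in> Arr C \<Longrightarrow> Dom C f \<in> Ob C"
    and Cod_Ob: "f \<in> Arr C \<Longrightarrow> Cod C f \<in> Ob C"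
    and Id_hom: "x \<in> Ob C \<Longrightarrow> Id C x \<in> homset C x x"
    and Comp_hom: "f \<in> homset C x y \<Longrightarrow> g \<in> homset C y z \<Longrightarrow> Comp C g f \<in> homset C x z"
    and Comp_Id: "f \<in> homset C x y \<Longrightarrow> Comp C f (Id C x) = f"
    and Id_Comp: "f \<in> homset C x y \<Longrightarrow> Comp C (Id C y) f = f"
    and Comp_assoc: "f \<in> homset C w x \<Longrightarrow> g \<in> homset C x y \<Longrightarrow> h \<in> homset C y z
      \<Longrightarrow> Comp C h (Comp C g f) = Comp C (Comp C h g) f"

definition isoset :: "('o, 'a) cat \<Rightarrow> 'o \<Rightarrow> 'o \<Rightarrow> 'a set" where
  "isoset C x y = {f \<in> homset C x y.
     \<exists>g \<in> homset C y x. Comp C g f = Id C x \<and> Comp C f g = Id C y}"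

definition isomorphic :: "('o, 'a) cat \<Rightarrow> 'o \<Rightarrow> 'o \<Rightarrow> bool" where
  "isomorphic C x y \<longleftrightarrow> x \<in> Ob C \<and> y \<in> Ob C \<and> isoset C x y \<noteq> {}"

definition aut_group :: "('o, 'a) cat \<Rightarrow> 'o \<Rightarrow> 'a monoid" where
  "aut_group C x = \<lparr>carrier = isoset C x x, mult = Comp C, one = Id C x\<rparr>"

locale groupoid = category +
  assumes invertible: "f \<in> Arr C \<Longrightarrow> f \<in> isoset C (Dom C f) (Cod C f)"

definition discrete_cat :: "'b set \<Rightarrow> ('b, 'b) cat" where
  "discrete_cat B = \<lparr>Ob = B, Arr = B, Dom = (\<lambda>b. b), Cod = (\<lambda>b. b), Id = (\<lambda>b. b), Comp = (\<lambda>c b. b)\<rparr>"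

definition op_cat :: "('o, 'a) cat \<Rightarrow> ('o, 'a) cat" where
  "op_cat C = \<lparr>Ob = Ob C, Arr = Arr C, Dom = Cod C, Cod = Dom C, Id = Id C,
     Comp = (\<lambda>g f. Comp C f g)\<rparr>"

section \<open>Functors and functor categories\<close>

text \<open>Functors are extensional (\<open>undefined\<close> off the objects and arrows of the domain), and so are
  the natural transformations and the functions in the category of sets below.
  Hence HOL equality of any of these is mathematical equality.\<close>

record ('o, 'a, 'p, 'c) funct =
  FOb :: "'o \<Rightarrow> 'p"
  FArr :: "'a \<Rightarrow> 'c"

definition is_functor :: "('o, 'a) cat \<Rightarrow> ('p, 'c) cat \<Rightarrow> ('o, 'a, 'p, 'c) funct \<Rightarrow> bool" where
  "is_functor C D F \<longleftrightarrow>
     FOb F \<in> Ob C \<rightarrow>\<^sub>E Ob D \<and> FArr F \<in> Arr C \<rightarrow>\<^sub>E Arr D \<and>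
     (\<forall>f \<in> Arr C. FArr F f \<in> homset D (FOb F (Dom C f)) (FOb F (Cod C f))) \<and>
     (\<forall>x \<in> Ob C. FArr F (Id C x) = Id D (FOb F x)) \<and>
     (\<forall>f \<in> Arr C. \<forall>g \<in> Arr C. Cod C f = Dom C g \<longrightarrow>
        FArr F (Comp C g f) = Comp D (FArr F g) (FArr F f))"

definition id_functor :: "('o, 'a) cat \<Rightarrow> ('o, 'a, 'o, 'a) funct" where
  "id_functor C = \<lparr>FOb = (\<lambda>x \<in> Ob C. x), FArr = (\<lambda>f \<in> Arr C. f)\<rparr>"

definition comp_functor ::
    "('o, 'a) cat \<Rightarrow> ('p, 'c, 'q, 'd) funct \<Rightarrow> ('o, 'a, 'p, 'c) funct \<Rightarrow> ('o, 'a, 'q, 'd) funct" where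
  "comp_functor C G F = \<lparr>FOb = compose (Ob C) (FOb G) (FOb F), FArr = compose (Arr C) (FArr G) (FArr F)\<rparr>"

definition iso_functor :: "('o, 'a) cat \<Rightarrow> ('p, 'c) cat \<Rightarrow> ('o, 'a, 'p, 'c) funct \<Rightarrow> bool" where
  "iso_functor C D F \<longleftrightarrow> is_functor C D F \<and>
     (\<exists>G. is_functor D C G \<and> comp_functor C G F = id_functor C \<and> comp_functor D F G = id_functor D)"

text \<open>An arrow that carries its endpoints is a triple \<open>(source, content, target)\<close>.\<close>

abbreviation src :: "'x \<times> 'y \<times> 'z \<Rightarrow> 'x" where "src t \<equiv> fst t"
abbreviation content :: "'x \<times> 'y \<times> 'z \<Rightarrow> 'y" where "content t \<equiv> fst (snd t)"
abbreviation tgt :: "'x \<times> 'y \<times> 'z \<Rightarrow> 'z" where "tgt t \<equiv> snd (snd t)"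

definition is_nat_trans :: "('o, 'a) cat \<Rightarrow> ('p, 'c) cat \<Rightarrow>
    ('o, 'a, 'p, 'c) funct \<Rightarrow> ('o \<Rightarrow> 'c) \<Rightarrow> ('o, 'a, 'p, 'c) funct \<Rightarrow> bool" where
  "is_nat_trans C D F \<alpha> G \<longleftrightarrow> \<alpha> \<in> extensional (Ob C) \<and>
     (\<forall>x \<in> Ob C. \<alpha> x \<in> homset D (FOb F x) (FOb G x)) \<and>
     (\<forall>f \<in> Arr C. Comp D (\<alpha> (Cod C f)) (FArr F f) = Comp D (FArr G f) (\<alpha> (Dom C f)))"

type_synonym ('o, 'a, 'p, 'c) ntrans =
  "('o, 'a, 'p, 'c) funct \<times> ('o \<Rightarrow> 'c) \<times> ('o, 'a, 'p, 'c) funct"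

definition functor_cat :: "('o, 'a) cat \<Rightarrow> ('p, 'c) cat \<Rightarrow>
    (('o, 'a, 'p, 'c) funct, ('o, 'a, 'p, 'c) ntrans) cat" where
  "functor_cat C D =
     \<lparr>Ob = {F. is_functor C D F},
      Arr = {(F, \<alpha>, G). is_functor C D F \<and> is_functor C D G \<and> is_nat_trans C D F \<alpha> G},
      Dom = src,
      Cod = tgt,
      Id = (\<lambda>F. (F, \<lambda>x \<in> Ob C. Id D (FOb F x), F)),
      Comp = (\<lambda>\<beta> \<alpha>. (src \<alpha>, \<lambda>x \<in> Ob C. Comp D (content \<beta> x) (content \<alpha> x), tgt \<beta>))\<rparr>"

definition whisker :: "('o, 'a) cat \<Rightarrow> ('p, 'c, 'q, 'd) ntrans \<Rightarrow> ('o, 'a, 'p, 'c) funct \<Rightarrow>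
    ('o, 'a, 'q, 'd) ntrans" where
  "whisker C \<sigma> p = (comp_functor C (src \<sigma>) p, \<lambda>x \<in> Ob C. content \<sigma> (FOb p x), comp_functor C (tgt \<sigma>) p)"

text \<open>\<open>is_lan C D M p F L \<eta>\<close>: the functor \<open>L : D \<rightarrow> M\<close> with unit \<open>\<eta> : F \<Rightarrow> L \<circ> p\<close> is a left Kan
  extension of \<open>F : C \<rightarrow> M\<close> along \<open>p : C \<rightarrow> D\<close>.\<close>

definition is_lan :: "('o, 'a) cat \<Rightarrow> ('p, 'c) cat \<Rightarrow> ('q, 'd) cat \<Rightarrow> ('o, 'a, 'p, 'c) funct \<Rightarrow>
    ('o, 'a, 'q, 'd) funct \<Rightarrow> ('p, 'c, 'q, 'd) funct \<Rightarrow> ('o, 'a, 'q, 'd) ntrans \<Rightarrow> bool" where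
  "is_lan C D M p F L \<eta> \<longleftrightarrow>
     is_functor D M L \<and> \<eta> \<in> homset (functor_cat C M) F (comp_functor C L p) \<and>
     (\<forall>G \<gamma>. is_functor D M G \<longrightarrow> \<gamma> \<in> homset (functor_cat C M) F (comp_functor C G p) \<longrightarrow>
        (\<exists>!\<sigma>. \<sigma> \<in> homset (functor_cat D M) L G \<and>
              Comp (functor_cat C M) (whisker C \<sigma> p) \<eta> = \<gamma>))"

section \<open>Presheaves\<close>

text \<open>\<open>set_cat\<close> is the category of all sets of elements of the type \<open>'v\<close>, which plays the role of the
  universe of small sets.\<close>

definition set_cat :: "('v set, 'v set \<times> ('v \<Rightarrow> 'v) \<times> 'v set) cat" where
  "set_cat =
     \<lparr>Ob = UNIV,
      Arr = {(X, f, Y). f \<in> X \<rightarrow>\<^sub>E Y},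
      Dom = src,
      Cod = tgt,
      Id = (\<lambda>X. (X, \<lambda>u \<in> X. u, X)),
      Comp = (\<lambda>g f. (src f, compose (src f) (content g) (content f), tgt g))\<rparr>"

type_synonym ('o, 'a, 'v) presheaf = "('o, 'a, 'v set, 'v set \<times> ('v \<Rightarrow> 'v) \<times> 'v set) funct"
type_synonym ('o, 'a, 'v) presheaf_hom = "('o, 'a, 'v set, 'v set \<times> ('v \<Rightarrow> 'v) \<times> 'v set) ntrans"

definition PSh :: "('o, 'a) cat \<Rightarrow> (('o, 'a, 'v) presheaf, ('o, 'a, 'v) presheaf_hom) cat" where
  "PSh E = functor_cat (op_cat E) set_cat"

text \<open>The arrows of \<open>E\<close> need not be elements of the universe \<open>'v\<close>; hom-sets are therefore transported
  along a map \<open>e :: 'a \<Rightarrow> 'v\<close>, to be assumed injective on arrows.\<close>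

definition yoneda_ob :: "('a \<Rightarrow> 'v) \<Rightarrow> ('o, 'a) cat \<Rightarrow> 'o \<Rightarrow> ('o, 'a, 'v) presheaf" where
  "yoneda_ob e E x =
     \<lparr>FOb = (\<lambda>z \<in> Ob E. e ` homset E z x),
      FArr = (\<lambda>f \<in> Arr E.
        (e ` homset E (Cod E f) x,
         \<lambda>u \<in> e ` homset E (Cod E f) x. e (Comp E (inv_into (Arr E) e u) f),
         e ` homset E (Dom E f) x))\<rparr>"

definition yoneda :: "('a \<Rightarrow> 'v) \<Rightarrow> ('o, 'a) cat \<Rightarrow>
    ('o, 'a, ('o, 'a, 'v) presheaf, ('o, 'a, 'v) presheaf_hom) funct" where
  "yoneda e E =
     \<lparr>FOb = (\<lambda>x \<in> Ob E. yoneda_ob e E x),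
      FArr = (\<lambda>g \<in> Arr E.
        (yoneda_ob e E (Dom E g),
         \<lambda>z \<in> Ob E.
           (e ` homset E z (Dom E g),
            \<lambda>u \<in> e ` homset E z (Dom E g). e (Comp E g (inv_into (Arr E) e u)),
            e ` homset E z (Cod E g)),
         yoneda_ob e E (Cod E g)))\<rparr>"

definition representable :: "('a \<Rightarrow> 'v) \<Rightarrow> ('o, 'a) cat \<Rightarrow> ('o, 'a, 'v) presheaf \<Rightarrow> bool" where
  "representable e E X \<longleftrightarrow> (\<exists>x \<in> Ob E. isomorphic (PSh E) X (FOb (yoneda e E) x))"

definition elements_cat :: "('o, 'a) cat \<Rightarrow> ('o, 'a, 'v) presheaf \<Rightarrow>
    ('o \<times> 'v, ('o \<times> 'v) \<times> 'a \<times> ('o \<times> 'v)) cat" where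
  "elements_cat E X =
     \<lparr>Ob = {(x, \<xi>). x \<in> Ob E \<and> \<xi> \<in> FOb X x},
      Arr = {((x, \<xi>), f, (x', \<xi>')). x \<in> Ob E \<and> \<xi> \<in> FOb X x \<and> x' \<in> Ob E \<and> \<xi>' \<in> FOb X x' \<and>
               f \<in> homset E x x' \<and> content (FArr X f) \<xi>' = \<xi>},
      Dom = src,
      Cod = tgt,
      Id = (\<lambda>s. (s, Id E (fst s), s)),
      Comp = (\<lambda>g f. (src f, Comp E (content g) (content f), tgt g))\<rparr>"

definition elements_proj :: "('o, 'a) cat \<Rightarrow> ('o, 'a, 'v) presheaf \<Rightarrow>
    ('o \<times> 'v, ('o \<times> 'v) \<times> 'a \<times> ('o \<times> 'v), 'o, 'a) funct" where
  "elements_proj E X =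
     \<lparr>FOb = (\<lambda>s \<in> Ob (elements_cat E X). fst s), FArr = (\<lambda>t \<in> Arr (elements_cat E X). content t)\<rparr>"

section \<open>Fibers\<close>

text \<open>For \<open>p\<close> with discrete codomain every arrow between objects over \<open>b\<close> lies over the identity
  of \<open>b\<close>, so the fiber is this full subcategory.\<close>

definition fiber :: "('o, 'a) cat \<Rightarrow> ('o, 'a, 'b, 'b) funct \<Rightarrow> 'b \<Rightarrow> ('o, 'a) cat" where
  "fiber E p b = E\<lparr>Ob := {x \<in> Ob E. FOb p x = b},
     Arr := {f \<in> Arr E. FOb p (Dom E f) = b \<and> FOb p (Cod E f) = b}\<rparr>"

text \<open>\<open>S\<close> is a subcategory of \<open>E\<close>, and \<open>pt\<close> is the element of the singleton.\<close>

definition char_presheaf :: "'v \<Rightarrow> ('o, 'a) cat \<Rightarrow> ('o, 'a) cat \<Rightarrow> ('o, 'a, 'v) presheaf" where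
  "char_presheaf pt E S =
     (let val = (\<lambda>x. if x \<in> Ob S then {pt} else {}) in
      \<lparr>FOb = (\<lambda>x \<in> Ob E. val x),
       FArr = (\<lambda>f \<in> Arr E. (val (Cod E f), \<lambda>u \<in> val (Cod E f). pt, val (Dom E f)))\<rparr>)"

end

theory Submission imports Defs begin

text \<open>
  Write \<open>F b\<close> for the characteristic presheaf of the fiber over \<open>b\<close>. It is subterminal: it has at most
  one element at each object. Since \<open>B\<close> is discrete, an arrow of \<open>E\<close> never leaves its fiber, so fibers
  are sieves and \<open>F b\<close> is indeed a presheaf. The point of the proof is that \<open>b \<mapsto> F b\<close> is itself a left
  Kan extension of the Yoneda embedding along \<open>p\<close> (\<open>fiber_lan_is_lan\<close>). Consider a natural family
  \<open>\<gamma> x : y x \<Rightarrow> G (p x)\<close>. For \<open>f : z \<rightarrow> x\<close> the arrow \<open>p f\<close> is an identity, so naturality gives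
  \<open>\<gamma> x (f) = \<gamma> z (id z)\<close> (\<open>cocone_eq_section\<close>). Thus \<open>\<gamma>\<close> amounts to the elements \<open>\<gamma> z (id z)\<close>, which are
  compatible under restriction along arrows of \<open>E\<close>. Such a compatible family over the fiber of \<open>b\<close> is
  exactly a map from \<open>F b\<close> to \<open>G b\<close> (\<open>fiber_lan_factorization\<close>).

  Every other left Kan extension \<open>A\<close> is isomorphic to this one (\<open>lan_unique\<close>), which gives the values
  of \<open>A b\<close> and its isomorphism with \<open>F b\<close> for every choice of the point. The remaining claims depend on
  these values alone. A presheaf with one element at each object of the fiber and none elsewhere has the
  fiber as its category of elements, by the projection (\<open>iso_functor_elements_proj\<close>); bijectivity on
  objects and isomorphisms of automorphism groups follow for any isomorphism of categories. If \<open>A b\<close> is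
  represented by \<open>x\<close>, then each \<open>z\<close> in the fiber has an arrow to \<open>x\<close>, hence is isomorphic to \<open>x\<close>
  and represents \<open>A b\<close> too: no single realization is distinguished. A fiber with two objects and only
  identity arrows shows that \<open>A b\<close> need not be representable at all
  (\<open>collapse_lan_not_representable\<close>).
\<close>

section \<open>Isomorphisms in a category\<close>

lemma in_homset_iff: "f \<in> homset C x y \<longleftrightarrow> f \<in> Arr C \<and> Dom C f = x \<and> Cod C f = y"
  by (simp add: homset_def)

lemma (in category) Comp_isoset:
  assumes f: "f \<in> isoset C x y" and g: "g \<in> isoset C y z"
  shows "Comp C g f \<in> isoset C x z"
proof -
  obtain f' where f': "f' \<in> homset C y x" "Comp C f' f = Id C x" "Comp C f f' = Id C y"
    using f by (auto simp: isoset_def)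
  obtain g' where g': "g' \<in> homset C z y" "Comp C g' g = Id C y" "Comp C g g' = Id C z"
    using g by (auto simp: isoset_def)
  have fh: "f \<in> homset C x y" and gh: "g \<in> homset C y z"
    using f g by (auto simp: isoset_def)
  have gf: "Comp C g f \<in> homset C x z" and fg: "Comp C f' g' \<in> homset C z x"
    using Comp_hom fh gh f' g' by blast+
  have "Comp C (Comp C f' g') (Comp C g f) = Comp C f' (Comp C (Comp C g' g) f)"
    using Comp_assoc[OF gf g'(1) f'(1)] Comp_assoc[OF fh gh g'(1)] by simp
  also have "\<dots> = Id C x"
    using g'(2) f'(2) Id_Comp[OF fh] by simp
  finally have 1: "Comp C (Comp C f' g') (Comp C g f) = Id C x" .
  have "Comp C (Comp C g f) (Comp C f' g') = Comp C g (Comp C (Comp C f f') g')"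
    using Comp_assoc[OF fg fh gh] Comp_assoc[OF g'(1) f'(1) fh] by simp
  also have "\<dots> = Id C z"
    using g'(3) f'(3) Id_Comp[OF g'(1)] by simp
  finally have 2: "Comp C (Comp C g f) (Comp C f' g') = Id C z" .
  show ?thesis
    using gf fg 1 2 unfolding isoset_def by blast
qed

lemma isomorphic_sym: "isomorphic C x y \<Longrightarrow> isomorphic C y x"
  unfolding isomorphic_def isoset_def by blast

lemma (in category) isomorphic_trans:
  "isomorphic C x y \<Longrightarrow> isomorphic C y z \<Longrightarrow> isomorphic C x z"
  unfolding isomorphic_def using Comp_isoset by blast

lemma functor_Ob: "is_functor C D F \<Longrightarrow> x \<in> Ob C \<Longrightarrow> FOb F x \<in> Ob D"
  by (auto simp: is_functor_def)

lemma functor_homset: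
  "is_functor C D F \<Longrightarrow> f \<in> homset C x y \<Longrightarrow> FArr F f \<in> homset D (FOb F x) (FOb F y)"
  by (auto simp: is_functor_def in_homset_iff)

lemma functor_Id: "is_functor C D F \<Longrightarrow> x \<in> Ob C \<Longrightarrow> FArr F (Id C x) = Id D (FOb F x)"
  by (auto simp: is_functor_def)

lemma functor_Comp:
  "is_functor C D F \<Longrightarrow> f \<in> homset C x y \<Longrightarrow> g \<in> homset C y z \<Longrightarrow>
    FArr F (Comp C g f) = Comp D (FArr F g) (FArr F f)"
  by (auto simp: is_functor_def in_homset_iff)

lemma functor_isoset:
  assumes F: "is_functor C D F" and f: "f \<in> isoset C x y" and "x \<in> Ob C" "y \<in> Ob C"
  shows "FArr F f \<in> isoset D (FOb F x) (FOb F y)"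
proof -
  obtain g where g: "g \<in> homset C y x" "Comp C g f = Id C x" "Comp C f g = Id C y"
    using f by (auto simp: isoset_def)
  have fh: "f \<in> homset C x y"
    using f by (auto simp: isoset_def)
  have "FArr F f \<in> homset D (FOb F x) (FOb F y)" "FArr F g \<in> homset D (FOb F y) (FOb F x)"
    using functor_homset[OF F] fh g(1) by blast+
  moreover have "Comp D (FArr F g) (FArr F f) = Id D (FOb F x)"
    "Comp D (FArr F f) (FArr F g) = Id D (FOb F y)"
    using functor_Comp[OF F fh g(1)] functor_Comp[OF F g(1) fh] functor_Id[OF F] g(2,3) assms(3,4)
    by simp_all
  ultimately show ?thesis
    unfolding isoset_def by blast
qed

lemma functor_isomorphic:
  assumes F: "is_functor C D F" and xy: "isomorphic C x y"
  shows "isomorphic D (FOb F x) (FOb F y)"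
proof -
  have "FOb F x \<in> Ob D" "FOb F y \<in> Ob D"
    using F xy unfolding is_functor_def isomorphic_def by auto
  then show ?thesis
    using functor_isoset[OF F] xy unfolding isomorphic_def by blast
qed

lemma iso_functor_bij_betw_Ob:
  assumes "iso_functor C D F"
  shows "bij_betw (FOb F) (Ob C) (Ob D)"
proof -
  obtain G where F: "is_functor C D F" and G: "is_functor D C G"
    and GF: "comp_functor C G F = id_functor C" and FG: "comp_functor D F G = id_functor D"
    using assms unfolding iso_functor_def by blast
  have 1: "FOb G (FOb F x) = x" if "x \<in> Ob C" for x
    using arg_cong[OF GF, of "\<lambda>H. FOb H x"] that
    by (simp add: comp_functor_def id_functor_def compose_def)
  have 2: "FOb F (FOb G x) = x" if "x \<in> Ob D" for x
    using arg_cong[OF FG, of "\<lambda>H. FOb H x"] that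
    by (simp add: comp_functor_def id_functor_def compose_def)
  show ?thesis
    by (rule bij_betw_byWitness[where f' = "FOb G"])
      (use 1 2 F G in \<open>auto simp: is_functor_def\<close>)
qed

lemma iso_functor_iso_aut_group:
  assumes "iso_functor C D F" and s: "s \<in> Ob C"
  shows "FArr F \<in> iso (aut_group C s) (aut_group D (FOb F s))"
proof -
  obtain G where F: "is_functor C D F" and G: "is_functor D C G"
    and GF: "comp_functor C G F = id_functor C" and FG: "comp_functor D F G = id_functor D"
    using assms unfolding iso_functor_def by blast
  have Gs: "FOb G (FOb F s) = s"
    using arg_cong[OF GF, of "\<lambda>H. FOb H s"] s
    by (simp add: comp_functor_def id_functor_def compose_def)
  have 1: "FArr G (FArr F f) = f" if "f \<in> Arr C" for f
    using arg_cong[OF GF, of "\<lambda>H. FArr H f"] that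
    by (simp add: comp_functor_def id_functor_def compose_def)
  have 2: "FArr F (FArr G f) = f" if "f \<in> Arr D" for f
    using arg_cong[OF FG, of "\<lambda>H. FArr H f"] that
    by (simp add: comp_functor_def id_functor_def compose_def)
  have Fs: "FOb F s \<in> Ob D"
    using F s by (auto simp: is_functor_def)
  have FI: "FArr F f \<in> isoset D (FOb F s) (FOb F s)" if "f \<in> isoset C s s" for f
    using functor_isoset[OF F that s s] .
  have GI: "FArr G f \<in> isoset C s s" if "f \<in> isoset D (FOb F s) (FOb F s)" for f
    using functor_isoset[OF G that Fs Fs] Gs by simp
  have iso_Arr: "f \<in> isoset C s s \<Longrightarrow> f \<in> Arr C"
    "g \<in> isoset D (FOb F s) (FOb F s) \<Longrightarrow> g \<in> Arr D" for f g
    by (auto simp: isoset_def in_homset_iff)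
  have "bij_betw (FArr F) (isoset C s s) (isoset D (FOb F s) (FOb F s))"
    by (rule bij_betw_byWitness[where f' = "FArr G"])
      (use 1 2 FI GI iso_Arr in \<open>auto simp: image_subset_iff\<close>)
  moreover have "FArr F (Comp C g f) = Comp D (FArr F g) (FArr F f)"
    if "f \<in> isoset C s s" "g \<in> isoset C s s" for f g
    using F that by (auto simp: isoset_def in_homset_iff is_functor_def)
  ultimately show ?thesis
    using FI by (auto simp: iso_def hom_def aut_group_def)
qed

section \<open>Functor categories and the uniqueness of left Kan extensions\<close>

lemma in_homset_functor_cat:
  "t \<in> homset (functor_cat C D) F G \<longleftrightarrow>
     src t = F \<and> tgt t = G \<and> is_functor C D F \<and> is_functor C D G \<and>
     is_nat_trans C D F (content t) G"
  by (cases t) (auto simp: functor_cat_def homset_def)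

lemma functor_cat_sel:
  "Ob (functor_cat C D) = {F. is_functor C D F}"
  "Id (functor_cat C D) = (\<lambda>F. (F, \<lambda>x \<in> Ob C. Id D (FOb F x), F))"
  "Comp (functor_cat C D) =
     (\<lambda>\<beta> \<alpha>. (src \<alpha>, \<lambda>x \<in> Ob C. Comp D (content \<beta> x) (content \<alpha> x), tgt \<beta>))"
  by (simp_all add: functor_cat_def)

lemma nat_trans_id:
  assumes "category C" "category D" and F: "is_functor C D F"
  shows "is_nat_trans C D F (\<lambda>x \<in> Ob C. Id D (FOb F x)) F"
proof -
  interpret C: category C by fact
  interpret D: category D by fact
  have "Comp D (Id D (FOb F (Cod C f))) (FArr F f) = Comp D (FArr F f) (Id D (FOb F (Dom C f)))"
    if "f \<in> Arr C" for f
  proof -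
    have "FArr F f \<in> homset D (FOb F (Dom C f)) (FOb F (Cod C f))"
      using F that by (auto simp: is_functor_def)
    then show ?thesis
      using D.Comp_Id D.Id_Comp by simp
  qed
  then show ?thesis
    using functor_Ob[OF F] D.Id_hom C.Dom_Ob C.Cod_Ob by (auto simp: is_nat_trans_def)
qed

lemma nat_trans_comp:
  assumes "category C" "category D"
    and F: "is_functor C D F" and G: "is_functor C D G" and H: "is_functor C D H"
    and \<alpha>: "is_nat_trans C D F \<alpha> G" and \<beta>: "is_nat_trans C D G \<beta> H"
  shows "is_nat_trans C D F (\<lambda>x \<in> Ob C. Comp D (\<beta> x) (\<alpha> x)) H"
proof -
  interpret C: category C by fact
  interpret D: category D by fact
  have a: "\<alpha> x \<in> homset D (FOb F x) (FOb G x)" and b: "\<beta> x \<in> homset D (FOb G x) (FOb H x)"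
    if "x \<in> Ob C" for x
    using \<alpha> \<beta> that by (auto simp: is_nat_trans_def)
  have "Comp D (Comp D (\<beta> y) (\<alpha> y)) (FArr F f) = Comp D (FArr H f) (Comp D (\<beta> x) (\<alpha> x))"
    if f: "f \<in> Arr C" and x: "x = Dom C f" and y: "y = Cod C f" for f x y
  proof -
    have xy: "x \<in> Ob C" "y \<in> Ob C"
      using f x y C.Dom_Ob C.Cod_Ob by auto
    have Ff: "FArr F f \<in> homset D (FOb F x) (FOb F y)"
      and Gf: "FArr G f \<in> homset D (FOb G x) (FOb G y)"
      and Hf: "FArr H f \<in> homset D (FOb H x) (FOb H y)"
      using F G H f x y by (auto simp: is_functor_def)
    have n: "Comp D (\<alpha> y) (FArr F f) = Comp D (FArr G f) (\<alpha> x)"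
      "Comp D (\<beta> y) (FArr G f) = Comp D (FArr H f) (\<beta> x)"
      using \<alpha> \<beta> f x y by (auto simp: is_nat_trans_def)
    have "Comp D (Comp D (\<beta> y) (\<alpha> y)) (FArr F f) = Comp D (\<beta> y) (Comp D (FArr G f) (\<alpha> x))"
      using D.Comp_assoc[OF Ff a[OF xy(2)] b[OF xy(2)]] n by simp
    also have "\<dots> = Comp D (Comp D (FArr H f) (\<beta> x)) (\<alpha> x)"
      using D.Comp_assoc[OF a[OF xy(1)] Gf b[OF xy(2)]] n by simp
    also have "\<dots> = Comp D (FArr H f) (Comp D (\<beta> x) (\<alpha> x))"
      using D.Comp_assoc[OF a[OF xy(1)] b[OF xy(1)] Hf] by simp
    finally show ?thesis .
  qed
  moreover have "Comp D (\<beta> x) (\<alpha> x) \<in> homset D (FOb F x) (FOb H x)" if "x \<in> Ob C" for x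
    using D.Comp_hom[OF a[OF that] b[OF that]] .
  ultimately show ?thesis
    using C.Dom_Ob C.Cod_Ob by (auto simp: is_nat_trans_def)
qed

lemma category_functor_cat:
  assumes C: "category C" and D: "category D"
  shows "category (functor_cat C D)"
proof -
  interpret D: category D by fact
  have at: "content t x \<in> homset D (FOb F x) (FOb G x)"
    if "t \<in> homset (functor_cat C D) F G" "x \<in> Ob C" for t F G x
    using that by (auto simp: in_homset_functor_cat is_nat_trans_def)
  have ext: "content t \<in> extensional (Ob C)" if "t \<in> homset (functor_cat C D) F G" for t F G
    using that by (auto simp: in_homset_functor_cat is_nat_trans_def)
  show ?thesis
  proof
    fix t assume "t \<in> Arr (functor_cat C D)"
    then show "Dom (functor_cat C D) t \<in> Ob (functor_cat C D)"
      "Cod (functor_cat C D) t \<in> Ob (functor_cat C D)"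
      by (auto simp: functor_cat_def)
  next
    fix F assume "F \<in> Ob (functor_cat C D)"
    then show "Id (functor_cat C D) F \<in> homset (functor_cat C D) F F"
      using nat_trans_id[OF C D] by (simp add: in_homset_functor_cat functor_cat_sel)
  next
    fix s t F G H
    assume "s \<in> homset (functor_cat C D) F G" "t \<in> homset (functor_cat C D) G H"
    then show "Comp (functor_cat C D) t s \<in> homset (functor_cat C D) F H"
      using nat_trans_comp[OF C D, of F G H "content s" "content t"]
      by (auto simp: in_homset_functor_cat functor_cat_sel)
  next
    fix t F G
    assume t: "t \<in> homset (functor_cat C D) F G"
    then have "src t = F" "tgt t = G"
      by (auto simp: in_homset_functor_cat)
    moreover have "(\<lambda>x\<in>Ob C. Comp D (content t x) (Id D (FOb F x))) = content t"
      "(\<lambda>x\<in>Ob C. Comp D (Id D (FOb G x)) (content t x)) = content t"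
      using ext[OF t] D.Comp_Id[OF at[OF t]] D.Id_Comp[OF at[OF t]]
      by (auto intro!: extensionalityI[of _ "Ob C"])
    ultimately show "Comp (functor_cat C D) t (Id (functor_cat C D) F) = t"
      "Comp (functor_cat C D) (Id (functor_cat C D) G) t = t"
      by (auto simp: functor_cat_sel prod_eq_iff cong: restrict_cong)
  next
    fix r s t F G H K
    assume r: "r \<in> homset (functor_cat C D) F G" and s: "s \<in> homset (functor_cat C D) G H"
      and t: "t \<in> homset (functor_cat C D) H K"
    then show "Comp (functor_cat C D) t (Comp (functor_cat C D) s r) =
      Comp (functor_cat C D) (Comp (functor_cat C D) t s) r"
      using D.Comp_assoc[OF at[OF r] at[OF s] at[OF t]] by (auto simp: functor_cat_sel intro!: restrict_ext)
  qed
qed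

lemma isoset_functor_cat_component:
  assumes t: "t \<in> isoset (functor_cat C D) F G" and x: "x \<in> Ob C"
  shows "content t x \<in> isoset D (FOb F x) (FOb G x)"
proof -
  obtain u where u: "u \<in> homset (functor_cat C D) G F"
    and ut: "Comp (functor_cat C D) u t = Id (functor_cat C D) F"
    and tu: "Comp (functor_cat C D) t u = Id (functor_cat C D) G"
    using t by (auto simp: isoset_def)
  have "Comp D (content u x) (content t x) = Id D (FOb F x)"
    using arg_cong[OF ut, of "\<lambda>r. content r x"] x by (simp add: functor_cat_sel)
  moreover have "Comp D (content t x) (content u x) = Id D (FOb G x)"
    using arg_cong[OF tu, of "\<lambda>r. content r x"] x by (simp add: functor_cat_sel)
  ultimately show ?thesis
    using t u x unfolding isoset_def in_homset_functor_cat is_nat_trans_def by blast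
qed

lemma isomorphic_functor_cat_component:
  assumes "isomorphic (functor_cat C D) F G" and x: "x \<in> Ob C"
  shows "isomorphic D (FOb F x) (FOb G x)"
proof -
  obtain t where t: "t \<in> isoset (functor_cat C D) F G"
    using assms(1) unfolding isomorphic_def by blast
  moreover have "FOb F x \<in> Ob D" "FOb G x \<in> Ob D"
    using assms unfolding isomorphic_def functor_cat_sel is_functor_def by auto
  ultimately show ?thesis
    using isoset_functor_cat_component[OF t x] unfolding isomorphic_def by blast
qed

lemma is_functor_comp_functor:
  assumes "category C" and F: "is_functor C D F" and G: "is_functor D M G"
  shows "is_functor C M (comp_functor C G F)"
proof -
  interpret C: category C by fact
  have 1: "Comp C g f \<in> Arr C" if "f \<in> Arr C" "g \<in> Arr C" "Cod C f = Dom C g" for f g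
    using C.Comp_hom[of f "Dom C f" "Cod C f" g "Cod C g"] that by (auto simp: in_homset_iff)
  have 2: "Id C x \<in> Arr C" if "x \<in> Ob C" for x
    using C.Id_hom[OF that] by (auto simp: in_homset_iff)
  have FO: "FOb F x \<in> Ob D" if "x \<in> Ob C" for x
    using F that by (auto simp: is_functor_def)
  have FA: "FArr F f \<in> Arr D" "Dom D (FArr F f) = FOb F (Dom C f)"
    "Cod D (FArr F f) = FOb F (Cod C f)" if "f \<in> Arr C" for f
    using F that by (auto simp: is_functor_def in_homset_iff)
  have GA: "FArr G f \<in> homset M (FOb G (Dom D f)) (FOb G (Cod D f))" if "f \<in> Arr D" for f
    using G that by (auto simp: is_functor_def)
  have "FArr G (FArr F f) \<in> homset M (FOb G (FOb F (Dom C f))) (FOb G (FOb F (Cod C f)))"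
    if "f \<in> Arr C" for f
    using GA[OF FA(1)[OF that]] FA[OF that] by simp
  moreover have "FArr G (FArr F (Comp C g f)) = Comp M (FArr G (FArr F g)) (FArr G (FArr F f))"
    if "f \<in> Arr C" "g \<in> Arr C" "Cod C f = Dom C g" for f g
    using F G FA that by (simp add: is_functor_def)
  moreover have "FArr G (FArr F (Id C x)) = Id M (FOb G (FOb F x))" if "x \<in> Ob C" for x
    using F G FO that by (simp add: is_functor_def)
  moreover have "FOb G (FOb F x) \<in> Ob M" if "x \<in> Ob C" for x
    using G FO[OF that] by (auto simp: is_functor_def)
  ultimately show ?thesis
    unfolding is_functor_def comp_functor_def
    by (auto simp: compose_def 1 2 C.Dom_Ob C.Cod_Ob in_homset_iff)
qed

text \<open>Whiskering by \<open>p\<close> is functorial, which lets the universal property be applied to composites of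
  comparison maps.\<close>

lemma whisker_homset:
  assumes C: "category C" and p: "is_functor C D p" and \<sigma>: "\<sigma> \<in> homset (functor_cat D M) L G"
  shows "whisker C \<sigma> p \<in> homset (functor_cat C M) (comp_functor C L p) (comp_functor C G p)"
proof -
  interpret C: category C by fact
  have s: "src \<sigma> = L" "tgt \<sigma> = G" and LG: "is_functor D M L" "is_functor D M G"
    and n: "is_nat_trans D M L (content \<sigma>) G"
    using \<sigma> by (auto simp: in_homset_functor_cat)
  have FO: "FOb p x \<in> Ob D" if "x \<in> Ob C" for x
    using p that by (auto simp: is_functor_def)
  have FA: "FArr p f \<in> Arr D" "Dom D (FArr p f) = FOb p (Dom C f)"
    "Cod D (FArr p f) = FOb p (Cod C f)" if "f \<in> Arr C" for f
    using p that by (auto simp: is_functor_def in_homset_iff)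
  have "Comp M (content \<sigma> (FOb p (Cod C f))) (FArr L (FArr p f)) =
      Comp M (FArr G (FArr p f)) (content \<sigma> (FOb p (Dom C f)))" if "f \<in> Arr C" for f
    using n FA[OF that] unfolding is_nat_trans_def by metis
  then have "is_nat_trans C M (comp_functor C L p) (\<lambda>x\<in>Ob C. content \<sigma> (FOb p x)) (comp_functor C G p)"
    using n FO C.Dom_Ob C.Cod_Ob
    by (auto simp: is_nat_trans_def comp_functor_def compose_def)
  then show ?thesis
    using is_functor_comp_functor[OF C p LG(1)] is_functor_comp_functor[OF C p LG(2)] s
    by (simp add: in_homset_functor_cat whisker_def)
qed

lemma whisker_Comp:
  assumes p: "is_functor C D p"
  shows "whisker C (Comp (functor_cat D M) \<tau> \<sigma>) p =
    Comp (functor_cat C M) (whisker C \<tau> p) (whisker C \<sigma> p)"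
  using p by (auto simp: whisker_def functor_cat_sel is_functor_def intro!: restrict_ext)

lemma whisker_Id:
  assumes p: "is_functor C D p"
  shows "whisker C (Id (functor_cat D M) L) p = Id (functor_cat C M) (comp_functor C L p)"
  using p by (auto simp: whisker_def functor_cat_sel is_functor_def comp_functor_def compose_def
      intro!: restrict_ext)

text \<open>The comparison maps \<open>L \<Rightarrow> L'\<close> and \<open>L' \<Rightarrow> L\<close> given by the two universal properties are mutually
  inverse, because each composite fixes a unit and so agrees with the identity.\<close>

lemma lan_unique:
  assumes C: "category C" and D: "category D" and M: "category M" and p: "is_functor C D p"
    and L: "is_lan C D M p F L \<eta>" and L': "is_lan C D M p F L' \<eta>'"
  shows "isomorphic (functor_cat D M) L L'"
proof -
  interpret CM: category "functor_cat C M" by (rule category_functor_cat[OF C M])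
  interpret DM: category "functor_cat D M" by (rule category_functor_cat[OF D M])
  have comparison: "\<exists>\<sigma>. \<sigma> \<in> homset (functor_cat D M) L L' \<and>
      Comp (functor_cat C M) (whisker C \<sigma> p) \<eta> = \<eta>'"
    if "is_lan C D M p F L \<eta>" "is_lan C D M p F L' \<eta>'" for L L' \<eta> \<eta>'
    using that unfolding is_lan_def by blast
  have round_trip: "Comp (functor_cat D M) \<tau> \<sigma> = Id (functor_cat D M) L"
    if L: "is_lan C D M p F L \<eta>" and \<sigma>: "\<sigma> \<in> homset (functor_cat D M) L L'"
      and \<tau>: "\<tau> \<in> homset (functor_cat D M) L' L"
      and \<sigma>\<eta>: "Comp (functor_cat C M) (whisker C \<sigma> p) \<eta> = \<eta>'"
      and \<tau>\<eta>: "Comp (functor_cat C M) (whisker C \<tau> p) \<eta>' = \<eta>" for L L' \<eta> \<eta>' \<sigma> \<tau>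
  proof -
    have LF: "is_functor D M L" and \<eta>: "\<eta> \<in> homset (functor_cat C M) F (comp_functor C L p)"
      using L unfolding is_lan_def by blast+
    have "Comp (functor_cat C M) (whisker C (Comp (functor_cat D M) \<tau> \<sigma>) p) \<eta> = \<eta>"
      unfolding whisker_Comp[OF p]
      using CM.Comp_assoc[OF \<eta> whisker_homset[OF C p \<sigma>] whisker_homset[OF C p \<tau>]] \<sigma>\<eta> \<tau>\<eta>
      by simp
    moreover have "Comp (functor_cat C M) (whisker C (Id (functor_cat D M) L) p) \<eta> = \<eta>"
      unfolding whisker_Id[OF p] using CM.Id_Comp[OF \<eta>] .
    moreover have "Comp (functor_cat D M) \<tau> \<sigma> \<in> homset (functor_cat D M) L L"
      using DM.Comp_hom[OF \<sigma> \<tau>] .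
    moreover have "Id (functor_cat D M) L \<in> homset (functor_cat D M) L L"
      using DM.Id_hom LF by (simp add: functor_cat_sel)
    ultimately show ?thesis
      using L LF \<eta> unfolding is_lan_def by blast
  qed
  obtain \<sigma> where \<sigma>: "\<sigma> \<in> homset (functor_cat D M) L L'"
    "Comp (functor_cat C M) (whisker C \<sigma> p) \<eta> = \<eta>'"
    using comparison[OF L L'] by blast
  obtain \<tau> where \<tau>: "\<tau> \<in> homset (functor_cat D M) L' L"
    "Comp (functor_cat C M) (whisker C \<tau> p) \<eta>' = \<eta>"
    using comparison[OF L' L] by blast
  have "\<sigma> \<in> isoset (functor_cat D M) L L'"
    using \<sigma> \<tau> round_trip[OF L \<sigma>(1) \<tau>(1) \<sigma>(2) \<tau>(2)] round_trip[OF L' \<tau>(1) \<sigma>(1) \<tau>(2) \<sigma>(2)]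
    unfolding isoset_def by blast
  moreover have "L \<in> Ob (functor_cat D M)" "L' \<in> Ob (functor_cat D M)"
    using L L' by (auto simp: is_lan_def functor_cat_sel)
  ultimately show ?thesis
    unfolding isomorphic_def by blast
qed

section \<open>Presheaves by their elements\<close>

lemma in_homset_set_cat:
  "t \<in> homset set_cat X Y \<longleftrightarrow> src t = X \<and> tgt t = Y \<and> content t \<in> X \<rightarrow>\<^sub>E Y"
  by (cases t) (auto simp: set_cat_def homset_def)

lemma set_cat_sel:
  "Ob set_cat = UNIV"
  "Id set_cat = (\<lambda>X. (X, \<lambda>u \<in> X. u, X))"
  "Comp set_cat = (\<lambda>g f. (src f, compose (src f) (content g) (content f), tgt g))"
  by (simp_all add: set_cat_def)

lemma set_hom_mem: "t \<in> homset set_cat X Y \<Longrightarrow> u \<in> X \<Longrightarrow> content t u \<in> Y"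
  by (auto simp: in_homset_set_cat)

lemma set_hom_eq_iff:
  assumes "s \<in> homset set_cat X Y" "t \<in> homset set_cat X Y"
  shows "s = t \<longleftrightarrow> (\<forall>u \<in> X. content s u = content t u)"
  using assms by (auto simp: in_homset_set_cat prod_eq_iff PiE_iff intro: extensionalityI)

lemma category_set_cat: "category set_cat"
proof
  fix t :: "'v set \<times> ('v \<Rightarrow> 'v) \<times> 'v set"
  assume "t \<in> Arr set_cat"
  then show "Dom set_cat t \<in> Ob set_cat" "Cod set_cat t \<in> Ob set_cat"
    by (auto simp: set_cat_def)
next
  fix X :: "'v set"
  show "Id set_cat X \<in> homset set_cat X X"
    by (simp add: in_homset_set_cat set_cat_sel)
next
  fix s t :: "'v set \<times> ('v \<Rightarrow> 'v) \<times> 'v set" and X Y Z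
  assume "s \<in> homset set_cat X Y" "t \<in> homset set_cat Y Z"
  then show "Comp set_cat t s \<in> homset set_cat X Z"
    by (auto simp: in_homset_set_cat set_cat_sel compose_def)
next
  fix t :: "'v set \<times> ('v \<Rightarrow> 'v) \<times> 'v set" and X Y
  assume "t \<in> homset set_cat X Y"
  then show "Comp set_cat t (Id set_cat X) = t" "Comp set_cat (Id set_cat Y) t = t"
    by (auto simp: in_homset_set_cat set_cat_sel compose_def prod_eq_iff PiE_iff
        intro!: extensionalityI[of _ X])
next
  fix r s t :: "'v set \<times> ('v \<Rightarrow> 'v) \<times> 'v set" and W X Y Z
  assume "r \<in> homset set_cat W X" "s \<in> homset set_cat X Y" "t \<in> homset set_cat Y Z"
  then show "Comp set_cat t (Comp set_cat s r) = Comp set_cat (Comp set_cat t s) r"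
    by (auto simp: in_homset_set_cat set_cat_sel compose_def PiE_iff intro!: restrict_ext)
qed

text \<open>Applied to the components of an isomorphism of presheaves, this compares their numbers of elements
  object by object.\<close>

lemma isomorphic_set_cat_eqpoll:
  assumes "isomorphic set_cat X Y"
  shows "X \<approx> Y"
proof -
  obtain s t where s: "s \<in> homset set_cat X Y" and t: "t \<in> homset set_cat Y X"
    and ts: "Comp set_cat t s = Id set_cat X" and st: "Comp set_cat s t = Id set_cat Y"
    using assms by (auto simp: isomorphic_def isoset_def)
  have "content t (content s u) = u" if "u \<in> X" for u
    using arg_cong[OF ts, of "\<lambda>r. content r u"] s that
    by (simp add: set_cat_sel compose_def in_homset_set_cat)
  moreover have "content s (content t u) = u" if "u \<in> Y" for u
    using arg_cong[OF st, of "\<lambda>r. content r u"] t that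
    by (simp add: set_cat_sel compose_def in_homset_set_cat)
  ultimately have "bij_betw (content s) X Y"
    by (intro bij_betw_byWitness[where f' = "content t"]) (auto dest: set_hom_mem[OF s] set_hom_mem[OF t])
  then show ?thesis
    by (auto simp: eqpoll_def)
qed

lemma op_cat_sel [simp]:
  "Ob (op_cat C) = Ob C" "Arr (op_cat C) = Arr C" "Dom (op_cat C) = Cod C" "Cod (op_cat C) = Dom C"
  "Id (op_cat C) = Id C" "Comp (op_cat C) g f = Comp C f g"
  by (simp_all add: op_cat_def)

lemma homset_op_cat: "homset (op_cat C) x y = homset C y x"
  by (auto simp: homset_def)

lemma category_op_cat:
  assumes "category C"
  shows "category (op_cat C)"
proof -
  interpret category C by fact
  show ?thesis
    by unfold_locales
      (auto simp: homset_op_cat Dom_Ob Cod_Ob Id_hom Comp_hom Comp_Id Id_Comp Comp_assoc)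
qed

lemma category_PSh: "category E \<Longrightarrow> category (PSh E)"
  unfolding PSh_def by (rule category_functor_cat[OF category_op_cat category_set_cat])

abbreviation act :: "('o, 'a, 'v) presheaf \<Rightarrow> 'a \<Rightarrow> 'v \<Rightarrow> 'v" where
  "act X f u \<equiv> content (FArr X f) u"

abbreviation app :: "('o, 'a, 'v) presheaf_hom \<Rightarrow> 'o \<Rightarrow> 'v \<Rightarrow> 'v" where
  "app t x u \<equiv> content (content t x) u"

context category
begin

text \<open>All later verifications are equations between elements. This lemma and \<open>in_homset_PSh\<close> translate
  the equations between triples and extensional functions that define presheaves and their maps into
  such equations, once and for all.\<close>

lemma presheaf_iff:
  "X \<in> Ob (PSh C) \<longleftrightarrow>
     FOb X \<in> extensional (Ob C) \<and> FArr X \<in> extensional (Arr C) \<and>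
     (\<forall>f \<in> Arr C. FArr X f \<in> homset set_cat (FOb X (Cod C f)) (FOb X (Dom C f))) \<and>
     (\<forall>x \<in> Ob C. \<forall>u \<in> FOb X x. act X (Id C x) u = u) \<and>
     (\<forall>f \<in> Arr C. \<forall>g \<in> Arr C. Cod C f = Dom C g \<longrightarrow>
        (\<forall>u \<in> FOb X (Cod C g). act X (Comp C g f) u = act X f (act X g u)))"
  (is "_ \<longleftrightarrow> ?L \<and> ?M \<and> ?H \<and> ?I \<and> ?K")
proof -
  interpret S: category "set_cat :: ('v set, 'v set \<times> ('v \<Rightarrow> 'v) \<times> 'v set) cat"
    by (rule category_set_cat)
  have I: "FArr X (Id C x) = Id set_cat (FOb X x) \<longleftrightarrow> (\<forall>u \<in> FOb X x. act X (Id C x) u = u)"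
    if ?H "x \<in> Ob C" for x
  proof -
    have "FArr X (Id C x) \<in> homset set_cat (FOb X x) (FOb X x)"
      using that Id_hom[of x] unfolding in_homset_iff by metis
    then show ?thesis
      using set_hom_eq_iff S.Id_hom[of "FOb X x"] by (fastforce simp: set_cat_sel)
  qed
  have K: "FArr X (Comp C g f) = Comp set_cat (FArr X f) (FArr X g) \<longleftrightarrow>
      (\<forall>u \<in> FOb X (Cod C g). act X (Comp C g f) u = act X f (act X g u))"
    if H: ?H and f: "f \<in> Arr C" and g: "g \<in> Arr C" and fg: "Cod C f = Dom C g" for f g
  proof -
    have c: "Comp C g f \<in> homset C (Dom C f) (Cod C g)"
      using Comp_hom[of f "Dom C f" "Cod C f" g "Cod C g"] f g fg by (simp add: in_homset_iff)
    have 1: "FArr X (Comp C g f) \<in> homset set_cat (FOb X (Cod C g)) (FOb X (Dom C f))"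
      using H c unfolding in_homset_iff by metis
    have 3: "FArr X g \<in> homset set_cat (FOb X (Cod C g)) (FOb X (Dom C g))"
      and 4: "FArr X f \<in> homset set_cat (FOb X (Dom C g)) (FOb X (Dom C f))"
      using bspec[OF H g] bspec[OF H f] fg by simp_all
    have 2: "Comp set_cat (FArr X f) (FArr X g) \<in> homset set_cat (FOb X (Cod C g)) (FOb X (Dom C f))"
      using S.Comp_hom[OF 3 4] .
    have s: "src (FArr X g) = FOb X (Cod C g)"
      using 3 by (simp add: in_homset_set_cat)
    show ?thesis
      unfolding set_hom_eq_iff[OF 1 2] by (simp add: set_cat_sel compose_def s)
  qed
  have "X \<in> Ob (PSh C) \<longleftrightarrow> ?L \<and> ?M \<and> ?H \<and>
     (\<forall>x \<in> Ob C. FArr X (Id C x) = Id set_cat (FOb X x)) \<and>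
     (\<forall>f \<in> Arr C. \<forall>g \<in> Arr C. Cod C f = Dom C g \<longrightarrow>
        FArr X (Comp C g f) = Comp set_cat (FArr X f) (FArr X g))"
    by (auto simp: PSh_def functor_cat_sel is_functor_def PiE_iff set_cat_sel(1) in_homset_iff)
  also have "\<dots> \<longleftrightarrow> ?L \<and> ?M \<and> ?H \<and> ?I \<and> ?K"
    using I K by (intro conj_cong refl ball_cong imp_cong) blast+
  finally show ?thesis .
qed

lemma presheaf_act_hom:
  "X \<in> Ob (PSh C) \<Longrightarrow> f \<in> homset C x y \<Longrightarrow> FArr X f \<in> homset set_cat (FOb X y) (FOb X x)"
  unfolding presheaf_iff in_homset_iff[of f] by blast

lemma presheaf_act_mem:
  "X \<in> Ob (PSh C) \<Longrightarrow> f \<in> homset C x y \<Longrightarrow> u \<in> FOb X y \<Longrightarrow> act X f u \<in> FOb X x"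
  by (rule set_hom_mem[OF presheaf_act_hom])

lemma in_homset_PSh:
  "t \<in> homset (PSh C) X Y \<longleftrightarrow>
     src t = X \<and> tgt t = Y \<and> X \<in> Ob (PSh C) \<and> Y \<in> Ob (PSh C) \<and> content t \<in> extensional (Ob C) \<and>
     (\<forall>x \<in> Ob C. content t x \<in> homset set_cat (FOb X x) (FOb Y x)) \<and>
     (\<forall>f \<in> Arr C. \<forall>u \<in> FOb X (Cod C f).
        app t (Dom C f) (act X f u) = act Y f (app t (Cod C f) u))"
proof -
  interpret S: category "set_cat :: ('v set, 'v set \<times> ('v \<Rightarrow> 'v) \<times> 'v set) cat"
    by (rule category_set_cat)
  have N: "Comp set_cat (content t (Dom C f)) (FArr X f) = Comp set_cat (FArr Y f) (content t (Cod C f))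
      \<longleftrightarrow> (\<forall>u \<in> FOb X (Cod C f). app t (Dom C f) (act X f u) = act Y f (app t (Cod C f) u))"
    if X: "X \<in> Ob (PSh C)" and Y: "Y \<in> Ob (PSh C)" and f: "f \<in> Arr C"
      and t: "\<forall>x \<in> Ob C. content t x \<in> homset set_cat (FOb X x) (FOb Y x)" for f
  proof -
    have fh: "f \<in> homset C (Dom C f) (Cod C f)"
      using f by (simp add: in_homset_iff)
    note Xf = presheaf_act_hom[OF X fh] and Yf = presheaf_act_hom[OF Y fh]
    note td = bspec[OF t Dom_Ob[OF f]] and tc = bspec[OF t Cod_Ob[OF f]]
    have "src (FArr X f) = FOb X (Cod C f)" "src (content t (Cod C f)) = FOb X (Cod C f)"
      using Xf tc by (simp_all add: in_homset_set_cat)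
    then show ?thesis
      unfolding set_hom_eq_iff[OF S.Comp_hom[OF Xf td] S.Comp_hom[OF tc Yf]]
      by (simp add: set_cat_sel compose_def)
  qed
  have "t \<in> homset (PSh C) X Y \<longleftrightarrow>
     src t = X \<and> tgt t = Y \<and> X \<in> Ob (PSh C) \<and> Y \<in> Ob (PSh C) \<and> content t \<in> extensional (Ob C) \<and>
     (\<forall>x \<in> Ob C. content t x \<in> homset set_cat (FOb X x) (FOb Y x)) \<and>
     (\<forall>f \<in> Arr C.
        Comp set_cat (content t (Dom C f)) (FArr X f) = Comp set_cat (FArr Y f) (content t (Cod C f)))"
    unfolding PSh_def in_homset_functor_cat is_nat_trans_def by (auto simp: functor_cat_sel(1))
  also have "\<dots> \<longleftrightarrow>
     src t = X \<and> tgt t = Y \<and> X \<in> Ob (PSh C) \<and> Y \<in> Ob (PSh C) \<and> content t \<in> extensional (Ob C) \<and>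
     (\<forall>x \<in> Ob C. content t x \<in> homset set_cat (FOb X x) (FOb Y x)) \<and>
     (\<forall>f \<in> Arr C. \<forall>u \<in> FOb X (Cod C f).
        app t (Dom C f) (act X f u) = act Y f (app t (Cod C f) u))"
    using N by (intro conj_cong refl ball_cong) blast+
  finally show ?thesis .
qed

lemma presheaf_hom_mem:
  "t \<in> homset (PSh C) X Y \<Longrightarrow> x \<in> Ob C \<Longrightarrow> u \<in> FOb X x \<Longrightarrow> app t x u \<in> FOb Y x"
  by (rule set_hom_mem[of "content t x" "FOb X x"]) (simp_all add: in_homset_PSh)

lemma presheaf_hom_natural:
  "t \<in> homset (PSh C) X Y \<Longrightarrow> f \<in> homset C x y \<Longrightarrow> u \<in> FOb X y \<Longrightarrow>
    app t x (act X f u) = act Y f (app t y u)"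
  unfolding in_homset_PSh in_homset_iff[of f] by blast

lemma presheaf_hom_eqI:
  assumes s: "s \<in> homset (PSh C) X Y" and t: "t \<in> homset (PSh C) X Y"
    and eq: "\<And>x u. x \<in> Ob C \<Longrightarrow> u \<in> FOb X x \<Longrightarrow> app s x u = app t x u"
  shows "s = t"
proof -
  have "content s x = content t x" if x: "x \<in> Ob C" for x
  proof -
    have "content s x \<in> homset set_cat (FOb X x) (FOb Y x)"
      "content t x \<in> homset set_cat (FOb X x) (FOb Y x)"
      using s t x by (simp_all add: in_homset_PSh)
    then show ?thesis
      using eq[OF x] by (simp add: set_hom_eq_iff)
  qed
  then have "content s = content t"
    using s t by (auto simp: in_homset_PSh intro: extensionalityI)
  then show ?thesis
    using s t by (simp add: in_homset_PSh prod_eq_iff)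
qed

lemma app_Comp:
  assumes "s \<in> homset (PSh C) X Y" "x \<in> Ob C" "u \<in> FOb X x"
  shows "app (Comp (PSh C) t s) x u = app t x (app s x u)"
proof -
  have "src (content s x) = FOb X x"
    using assms by (simp add: in_homset_PSh in_homset_set_cat)
  then show ?thesis
    using assms by (simp add: PSh_def functor_cat_sel set_cat_sel compose_def)
qed

lemma app_Id: "x \<in> Ob C \<Longrightarrow> u \<in> FOb X x \<Longrightarrow> app (Id (PSh C) X) x u = u"
  by (simp add: PSh_def functor_cat_sel set_cat_sel)

lemma isomorphic_PSh_eqpoll:
  assumes "isomorphic (PSh C) X Y" "x \<in> Ob C"
  shows "FOb X x \<approx> FOb Y x"
  using isomorphic_functor_cat_component[of "op_cat C" set_cat X Y x] assms
  by (simp add: PSh_def isomorphic_set_cat_eqpoll)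

end

section \<open>The Yoneda embedding\<close>

text \<open>The map \<open>e\<close> places the arrows of \<open>E\<close> in the universe of the set-valued presheaves. Every element
  of a representable presheaf has the form \<open>e f\<close>, so that the rules below for \<open>e f\<close> remove \<open>inv_into\<close>
  from all further computations.\<close>

locale embedded_category = category E for E :: "('o, 'a) cat" +
  fixes e :: "'a \<Rightarrow> 'v"
  assumes inj_e: "inj_on e (Arr E)"
begin

sublocale P: category "PSh E :: (('o, 'a, 'v) presheaf, ('o, 'a, 'v) presheaf_hom) cat"
  by (rule category_PSh) unfold_locales

lemma inv_e: "f \<in> homset E x y \<Longrightarrow> inv_into (Arr E) e (e f) = f"
  using inj_e by (simp add: in_homset_iff)

lemma FOb_yoneda_ob: "z \<in> Ob E \<Longrightarrow> FOb (yoneda_ob e E x) z = e ` homset E z x"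
  by (simp add: yoneda_ob_def)

lemma act_yoneda_ob:
  assumes "f \<in> homset E w z" "g \<in> homset E z x"
  shows "act (yoneda_ob e E x) f (e g) = e (Comp E g f)"
  using assms inv_e[OF assms(2)] by (auto simp: yoneda_ob_def in_homset_iff)

lemma app_yoneda:
  assumes "g \<in> homset E x y" "f \<in> homset E z x"
  shows "app (FArr (yoneda e E) g) z (e f) = e (Comp E g f)"
  using assms inv_e[OF assms(2)] Dom_Ob[of f] by (auto simp: yoneda_def in_homset_iff)

lemma yoneda_ob_presheaf:
  assumes "x \<in> Ob E"
  shows "yoneda_ob e E x \<in> Ob (PSh E)"
  unfolding presheaf_iff
proof (intro conjI ballI impI)
  show "FOb (yoneda_ob e E x) \<in> extensional (Ob E)" "FArr (yoneda_ob e E x) \<in> extensional (Arr E)"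
    by (auto simp: yoneda_ob_def)
next
  fix f assume f: "f \<in> Arr E"
  have "e (Comp E g f) \<in> e ` homset E (Dom E f) x" if "g \<in> homset E (Cod E f) x" for g
    using Comp_hom[of f "Dom E f" "Cod E f" g x] f that by (simp add: in_homset_iff)
  then show "FArr (yoneda_ob e E x) f \<in>
      homset set_cat (FOb (yoneda_ob e E x) (Cod E f)) (FOb (yoneda_ob e E x) (Dom E f))"
    using f by (auto simp: in_homset_set_cat yoneda_ob_def Dom_Ob Cod_Ob inv_e)
next
  fix z u assume z: "z \<in> Ob E" and "u \<in> FOb (yoneda_ob e E x) z"
  then obtain g where "u = e g" "g \<in> homset E z x"
    by (auto simp: FOb_yoneda_ob)
  then show "act (yoneda_ob e E x) (Id E z) u = u"
    using act_yoneda_ob[OF Id_hom[OF z]] Comp_Id by simp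
next
  fix f g u
  assume f: "f \<in> Arr E" and g: "g \<in> Arr E" and fg: "Cod E f = Dom E g"
    and u: "u \<in> FOb (yoneda_ob e E x) (Cod E g)"
  obtain h where u: "u = e h" and h: "h \<in> homset E (Cod E g) x"
    using u g by (auto simp: FOb_yoneda_ob Cod_Ob)
  have fh: "f \<in> homset E (Dom E f) (Dom E g)" and gh: "g \<in> homset E (Dom E g) (Cod E g)"
    using f g fg by (simp_all add: in_homset_iff)
  show "act (yoneda_ob e E x) (Comp E g f) u = act (yoneda_ob e E x) f (act (yoneda_ob e E x) g u)"
    unfolding u act_yoneda_ob[OF gh h] act_yoneda_ob[OF fh Comp_hom[OF gh h]]
      act_yoneda_ob[OF Comp_hom[OF fh gh] h] Comp_assoc[OF fh gh h] ..
qed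

lemma yoneda_arr_hom:
  assumes g: "g \<in> homset E x y"
  shows "FArr (yoneda e E) g \<in> homset (PSh E) (yoneda_ob e E x) (yoneda_ob e E y)"
proof -
  have gA: "g \<in> Arr E" and xy: "Dom E g = x" "Cod E g = y"
    using g by (simp_all add: in_homset_iff)
  have ob: "x \<in> Ob E" "y \<in> Ob E"
    using gA xy Dom_Ob Cod_Ob by auto
  have hom: "content (FArr (yoneda e E) g) z \<in> homset set_cat (FOb (yoneda_ob e E x) z) (FOb (yoneda_ob e E y) z)"
    if "z \<in> Ob E" for z
    using gA xy that Comp_hom[OF _ g] by (auto simp: yoneda_def in_homset_set_cat FOb_yoneda_ob inv_e)
  have nat: "app (FArr (yoneda e E) g) (Dom E f) (act (yoneda_ob e E x) f u) =
      act (yoneda_ob e E y) f (app (FArr (yoneda e E) g) (Cod E f) u)"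
    if f: "f \<in> Arr E" and u: "u \<in> FOb (yoneda_ob e E x) (Cod E f)" for f u
  proof -
    obtain h where u: "u = e h" and h: "h \<in> homset E (Cod E f) x"
      using u f by (auto simp: FOb_yoneda_ob Cod_Ob)
    have fh: "f \<in> homset E (Dom E f) (Cod E f)"
      using f by (simp add: in_homset_iff)
    show ?thesis
      unfolding u act_yoneda_ob[OF fh h] app_yoneda[OF g h] app_yoneda[OF g Comp_hom[OF fh h]]
        act_yoneda_ob[OF fh Comp_hom[OF h g]] Comp_assoc[OF fh h g] ..
  qed
  show ?thesis
    unfolding in_homset_PSh
    using gA xy ob yoneda_ob_presheaf hom nat by (auto simp: yoneda_def)
qed

lemma FOb_yoneda: "x \<in> Ob E \<Longrightarrow> FOb (yoneda e E) x = yoneda_ob e E x"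
  by (simp add: yoneda_def)

lemma yoneda_functor: "is_functor E (PSh E) (yoneda e E)"
proof -
  have hom: "FArr (yoneda e E) g \<in> homset (PSh E) (FOb (yoneda e E) (Dom E g)) (FOb (yoneda e E) (Cod E g))"
    if "g \<in> Arr E" for g
    using yoneda_arr_hom[of g] that by (simp add: FOb_yoneda Dom_Ob Cod_Ob in_homset_iff)
  have id: "FArr (yoneda e E) (Id E x) = Id (PSh E) (FOb (yoneda e E) x)" if x: "x \<in> Ob E" for x
    unfolding FOb_yoneda[OF x]
  proof (rule presheaf_hom_eqI[OF yoneda_arr_hom[OF Id_hom[OF x]] P.Id_hom[OF yoneda_ob_presheaf[OF x]]])
    fix z u assume z: "z \<in> Ob E" and u: "u \<in> FOb (yoneda_ob e E x) z"
    then obtain h where h: "u = e h" "h \<in> homset E z x"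
      by (auto simp: FOb_yoneda_ob)
    show "app (FArr (yoneda e E) (Id E x)) z u = app (Id (PSh E) (yoneda_ob e E x)) z u"
      unfolding app_Id[OF z u] unfolding h(1) app_yoneda[OF Id_hom[OF x] h(2)] Id_Comp[OF h(2)] ..
  qed
  have comp: "FArr (yoneda e E) (Comp E g f) = Comp (PSh E) (FArr (yoneda e E) g) (FArr (yoneda e E) f)"
    if "f \<in> Arr E" "g \<in> Arr E" "Cod E f = Dom E g" for f g
  proof -
    have fh: "f \<in> homset E (Dom E f) (Dom E g)" and gh: "g \<in> homset E (Dom E g) (Cod E g)"
      using that by (simp_all add: in_homset_iff)
    show ?thesis
    proof (rule presheaf_hom_eqI[OF yoneda_arr_hom[OF Comp_hom[OF fh gh]]
            P.Comp_hom[OF yoneda_arr_hom[OF fh] yoneda_arr_hom[OF gh]]])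
      fix z u assume z: "z \<in> Ob E" and u: "u \<in> FOb (yoneda_ob e E (Dom E f)) z"
      then obtain h where h: "u = e h" "h \<in> homset E z (Dom E f)"
        by (auto simp: FOb_yoneda_ob)
      show "app (FArr (yoneda e E) (Comp E g f)) z u =
          app (Comp (PSh E) (FArr (yoneda e E) g) (FArr (yoneda e E) f)) z u"
        unfolding app_Comp[OF yoneda_arr_hom[OF fh] z u] unfolding h(1) app_yoneda[OF fh h(2)]
          app_yoneda[OF gh Comp_hom[OF h(2) fh]] app_yoneda[OF Comp_hom[OF fh gh] h(2)]
          Comp_assoc[OF h(2) fh gh] ..
    qed
  qed
  have "FOb (yoneda e E) \<in> extensional (Ob E)" "FArr (yoneda e E) \<in> extensional (Arr E)"
    by (auto simp: yoneda_def)
  then show ?thesis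
    using hom id comp yoneda_ob_presheaf
    by (auto simp: is_functor_def PiE_iff FOb_yoneda in_homset_iff)
qed

end

section \<open>Characteristic presheaves\<close>

lemma FOb_char:
  "x \<in> Ob E \<Longrightarrow> FOb (char_presheaf pt E S) x = (if x \<in> Ob S then {pt} else {})"
  by (simp add: char_presheaf_def)

text \<open>The two canonical maps: into a characteristic presheaf (a subterminal presheaf, so there is at
  most one), and out of it, where a map is the same as a compatible family of elements on \<open>S\<close>.\<close>

definition to_char :: "'v \<Rightarrow> ('o, 'a) cat \<Rightarrow> ('o, 'a) cat \<Rightarrow> ('o, 'a, 'v) presheaf \<Rightarrow>
    ('o, 'a, 'v) presheaf_hom" where
  "to_char pt E S X =
     (X, \<lambda>x \<in> Ob E. (FOb X x, \<lambda>u \<in> FOb X x. pt, FOb (char_presheaf pt E S) x), char_presheaf pt E S)"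

definition from_char :: "'v \<Rightarrow> ('o, 'a) cat \<Rightarrow> ('o, 'a) cat \<Rightarrow> ('o, 'a, 'v) presheaf \<Rightarrow> ('o \<Rightarrow> 'v) \<Rightarrow>
    ('o, 'a, 'v) presheaf_hom" where
  "from_char pt E S Y s =
     (char_presheaf pt E S,
      \<lambda>x \<in> Ob E. (FOb (char_presheaf pt E S) x, \<lambda>u \<in> FOb (char_presheaf pt E S) x. s x, FOb Y x), Y)"

context category
begin

lemma act_char:
  "f \<in> Arr C \<Longrightarrow> u \<in> FOb (char_presheaf pt C S) (Cod C f) \<Longrightarrow> act (char_presheaf pt C S) f u = pt"
  by (simp add: char_presheaf_def Cod_Ob)

lemma char_presheaf_presheaf:
  assumes sieve: "\<And>f. f \<in> Arr C \<Longrightarrow> Cod C f \<in> Ob S \<Longrightarrow> Dom C f \<in> Ob S"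
  shows "char_presheaf pt C S \<in> Ob (PSh C)"
proof -
  have "FArr (char_presheaf pt C S) f \<in> homset set_cat
      (FOb (char_presheaf pt C S) (Cod C f)) (FOb (char_presheaf pt C S) (Dom C f))"
    if "f \<in> Arr C" for f
    using sieve[OF that] that
    by (auto simp: in_homset_set_cat char_presheaf_def Dom_Ob Cod_Ob)
  moreover have "act (char_presheaf pt C S) (Id C x) u = u"
    if "x \<in> Ob C" "u \<in> FOb (char_presheaf pt C S) x" for x u
    using act_char[of "Id C x" u pt S] Id_hom[OF that(1)] that
    by (auto simp: in_homset_iff FOb_char split: if_splits)
  moreover have "act (char_presheaf pt C S) (Comp C g f) u =
      act (char_presheaf pt C S) f (act (char_presheaf pt C S) g u)"
    if f: "f \<in> Arr C" and g: "g \<in> Arr C" and fg: "Cod C f = Dom C g"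
      and u: "u \<in> FOb (char_presheaf pt C S) (Cod C g)" for f g u
  proof -
    have "Cod C g \<in> Ob S"
      using u g by (auto simp: FOb_char Cod_Ob split: if_splits)
    then have "pt \<in> FOb (char_presheaf pt C S) (Cod C f)"
      using sieve[OF g] f g fg by (simp add: FOb_char Dom_Ob)
    moreover have "Comp C g f \<in> Arr C" "Cod C (Comp C g f) = Cod C g"
      using Comp_hom[of f "Dom C f" "Cod C f" g "Cod C g"] f g fg by (auto simp: in_homset_iff)
    ultimately show ?thesis
      using u by (simp add: act_char f g)
  qed
  ultimately show ?thesis
    unfolding presheaf_iff by (auto simp: char_presheaf_def)
qed

lemma char_presheaf_subterminal:
  assumes "s \<in> homset (PSh C) X (char_presheaf pt C S)" "t \<in> homset (PSh C) X (char_presheaf pt C S)"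
  shows "s = t"
proof (rule presheaf_hom_eqI[OF assms])
  fix x u assume "x \<in> Ob C" "u \<in> FOb X x"
  then have "app s x u = pt" "app t x u = pt"
    using presheaf_hom_mem[OF assms(1)] presheaf_hom_mem[OF assms(2)]
    by (force simp: FOb_char split: if_splits)+
  then show "app s x u = app t x u"
    by simp
qed

lemma to_char_hom:
  assumes sieve: "\<And>f. f \<in> Arr C \<Longrightarrow> Cod C f \<in> Ob S \<Longrightarrow> Dom C f \<in> Ob S"
    and X: "X \<in> Ob (PSh C)" and supp: "\<And>x. x \<in> Ob C \<Longrightarrow> FOb X x \<noteq> {} \<Longrightarrow> x \<in> Ob S"
  shows "to_char pt C S X \<in> homset (PSh C) X (char_presheaf pt C S)"
proof -
  have "app (to_char pt C S X) (Dom C f) (act X f u) =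
      act (char_presheaf pt C S) f (app (to_char pt C S X) (Cod C f) u)"
    if f: "f \<in> Arr C" and u: "u \<in> FOb X (Cod C f)" for f u
  proof -
    have "act X f u \<in> FOb X (Dom C f)"
      using presheaf_act_mem[OF X _ u] f by (simp add: in_homset_iff)
    moreover have "pt \<in> FOb (char_presheaf pt C S) (Cod C f)"
      using supp[OF Cod_Ob[OF f]] u f by (auto simp: FOb_char Cod_Ob)
    ultimately show ?thesis
      using f u by (simp add: to_char_def act_char Dom_Ob Cod_Ob)
  qed
  moreover have "content (to_char pt C S X) x \<in> homset set_cat (FOb X x) (FOb (char_presheaf pt C S) x)"
    if "x \<in> Ob C" for x
    using supp[OF that] that by (auto simp: to_char_def in_homset_set_cat FOb_char)
  ultimately show ?thesis
    using X char_presheaf_presheaf[OF sieve] unfolding in_homset_PSh by (auto simp: to_char_def)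
qed

lemma from_char_hom:
  assumes sieve: "\<And>f. f \<in> Arr C \<Longrightarrow> Cod C f \<in> Ob S \<Longrightarrow> Dom C f \<in> Ob S"
    and Y: "Y \<in> Ob (PSh C)"
    and s: "\<And>x. x \<in> Ob C \<Longrightarrow> x \<in> Ob S \<Longrightarrow> s x \<in> FOb Y x"
    and compat: "\<And>f. f \<in> Arr C \<Longrightarrow> Cod C f \<in> Ob S \<Longrightarrow> act Y f (s (Cod C f)) = s (Dom C f)"
  shows "from_char pt C S Y s \<in> homset (PSh C) (char_presheaf pt C S) Y"
proof -
  have "app (from_char pt C S Y s) (Dom C f) (act (char_presheaf pt C S) f u) =
      act Y f (app (from_char pt C S Y s) (Cod C f) u)"
    if f: "f \<in> Arr C" and u: "u \<in> FOb (char_presheaf pt C S) (Cod C f)" for f u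
  proof -
    have cod: "Cod C f \<in> Ob S"
      using u f by (auto simp: FOb_char Cod_Ob split: if_splits)
    then have "act (char_presheaf pt C S) f u \<in> FOb (char_presheaf pt C S) (Dom C f)"
      using sieve[OF f] u f by (simp add: act_char FOb_char Dom_Ob)
    then show ?thesis
      using f u compat[OF f cod] by (simp add: from_char_def Dom_Ob Cod_Ob)
  qed
  moreover have "content (from_char pt C S Y s) x \<in>
      homset set_cat (FOb (char_presheaf pt C S) x) (FOb Y x)" if "x \<in> Ob C" for x
    using s[OF that] that by (auto simp: from_char_def in_homset_set_cat FOb_char)
  ultimately show ?thesis
    using Y char_presheaf_presheaf[OF sieve] unfolding in_homset_PSh by (auto simp: from_char_def)
qed

end

section \<open>Categories over a discrete category\<close>

lemma discrete_cat_sel [simp]: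
  "Ob (discrete_cat B) = B" "Arr (discrete_cat B) = B" "Dom (discrete_cat B) b = b"
  "Cod (discrete_cat B) b = b" "Id (discrete_cat B) b = b" "Comp (discrete_cat B) c b = b"
  by (simp_all add: discrete_cat_def)

lemma groupoid_discrete_cat: "groupoid (discrete_cat B)"
  by unfold_locales (auto simp: in_homset_iff isoset_def)

lemma fiber_sel [simp]:
  "Ob (fiber E p b) = {x \<in> Ob E. FOb p x = b}"
  "Arr (fiber E p b) = {f \<in> Arr E. FOb p (Dom E f) = b \<and> FOb p (Cod E f) = b}"
  "Dom (fiber E p b) = Dom E" "Cod (fiber E p b) = Cod E" "Id (fiber E p b) = Id E"
  "Comp (fiber E p b) = Comp E"
  by (simp_all add: fiber_def)

text \<open>The image of \<open>f\<close> is an arrow of a discrete category, hence an identity, so \<open>f\<close> stays in one fiber.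
  In particular every fiber is a sieve.\<close>

lemma functor_to_discrete:
  assumes "is_functor E (discrete_cat B) p" "f \<in> Arr E"
  shows "FArr p f = FOb p (Cod E f)" "FOb p (Dom E f) = FOb p (Cod E f)"
proof -
  have "FArr p f \<in> homset (discrete_cat B) (FOb p (Dom E f)) (FOb p (Cod E f))"
    using assms by (simp add: is_functor_def)
  then show "FArr p f = FOb p (Cod E f)" "FOb p (Dom E f) = FOb p (Cod E f)"
    by (auto simp: in_homset_iff)
qed

lemma functor_from_discrete_Arr:
  assumes "is_functor (discrete_cat B) M G" "b \<in> B"
  shows "FArr G b = Id M (FOb G b)"
  using functor_Id[OF assms(1), of b] assms(2) by simp

text \<open>Over a discrete index category any family of objects is a functor, and any family of arrows is
  natural.\<close>

definition discrete_diagram :: "('q, 'd) cat \<Rightarrow> 'b set \<Rightarrow> ('b \<Rightarrow> 'q) \<Rightarrow> ('b, 'b, 'q, 'd) funct" where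
  "discrete_diagram M B K = \<lparr>FOb = \<lambda>b \<in> B. K b, FArr = \<lambda>b \<in> B. Id M (K b)\<rparr>"

lemma discrete_diagram_functor:
  assumes "category M" "\<And>b. b \<in> B \<Longrightarrow> K b \<in> Ob M"
  shows "is_functor (discrete_cat B) M (discrete_diagram M B K)"
proof -
  interpret category M by fact
  show ?thesis
    using assms(2) Id_hom Comp_Id[OF Id_hom]
    by (auto simp: is_functor_def discrete_diagram_def in_homset_iff)
qed

lemma discrete_nat_trans:
  assumes "category M" and L: "is_functor (discrete_cat B) M L" and G: "is_functor (discrete_cat B) M G"
    and \<sigma>: "\<And>b. b \<in> B \<Longrightarrow> \<sigma> b \<in> homset M (FOb L b) (FOb G b)"
  shows "(L, \<lambda>b \<in> B. \<sigma> b, G) \<in> homset (functor_cat (discrete_cat B) M) L G"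
proof -
  interpret category M by fact
  show ?thesis
    using L G \<sigma> Comp_Id[OF \<sigma>] Id_Comp[OF \<sigma>]
    by (auto simp: in_homset_functor_cat is_nat_trans_def functor_from_discrete_Arr)
qed

lemma functor_cat_hom_eqI:
  assumes "s \<in> homset (functor_cat C D) F G" "t \<in> homset (functor_cat C D) F G"
    and "\<And>x. x \<in> Ob C \<Longrightarrow> content s x = content t x"
  shows "s = t"
  using assms
  by (auto simp: in_homset_functor_cat is_nat_trans_def prod_eq_iff intro: extensionalityI)

section \<open>The left Kan extension\<close>

locale fibered_category = embedded_category E e
  for E :: "('o, 'a) cat" and e :: "'a \<Rightarrow> 'v" +
  fixes B :: "'b set" and p :: "('o, 'a, 'b, 'b) funct"
  assumes p: "is_functor E (discrete_cat B) p"
begin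

lemma p_mem: "x \<in> Ob E \<Longrightarrow> FOb p x \<in> B"
  using functor_Ob[OF p] by simp

lemma fiber_sieve: "f \<in> Arr E \<Longrightarrow> Cod E f \<in> Ob (fiber E p b) \<Longrightarrow> Dom E f \<in> Ob (fiber E p b)"
  using functor_to_discrete(2)[OF p] Dom_Ob by simp

definition fiber_char :: "'v \<Rightarrow> 'b \<Rightarrow> ('o, 'a, 'v) presheaf" where
  "fiber_char pt b = char_presheaf pt E (fiber E p b)"

definition fiber_lan :: "'v \<Rightarrow> ('b, 'b, ('o, 'a, 'v) presheaf, ('o, 'a, 'v) presheaf_hom) funct" where
  "fiber_lan pt = discrete_diagram (PSh E) B (fiber_char pt)"

text \<open>At \<open>x\<close> the unit sends each arrow into \<open>x\<close> to the point over its source, which lies in the same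
  fiber as \<open>x\<close>.\<close>

definition fiber_unit :: "'v \<Rightarrow> ('o, 'a, ('o, 'a, 'v) presheaf, ('o, 'a, 'v) presheaf_hom) ntrans" where
  "fiber_unit pt =
     (yoneda e E,
      \<lambda>x \<in> Ob E. to_char pt E (fiber E p (FOb p x)) (yoneda_ob e E x),
      comp_functor E (fiber_lan pt) p)"

lemma FOb_fiber_char:
  "x \<in> Ob E \<Longrightarrow> FOb (fiber_char pt b) x = (if FOb p x = b then {pt} else {})"
  by (simp add: fiber_char_def FOb_char)

lemma FOb_fiber_lan: "b \<in> B \<Longrightarrow> FOb (fiber_lan pt) b = fiber_char pt b"
  by (simp add: fiber_lan_def discrete_diagram_def)

lemma fiber_lan_functor: "is_functor (discrete_cat B) (PSh E) (fiber_lan pt)"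
  unfolding fiber_lan_def fiber_char_def
  by (rule discrete_diagram_functor[OF P.category_axioms]) (rule char_presheaf_presheaf[OF fiber_sieve])

lemma comp_functor_p_Ob: "x \<in> Ob E \<Longrightarrow> FOb (comp_functor E G p) x = FOb G (FOb p x)"
  by (simp add: comp_functor_def compose_def)

lemma comp_functor_p_Arr:
  assumes "is_functor (discrete_cat B) M G" and f: "f \<in> Arr E"
  shows "FArr (comp_functor E G p) f = Id M (FOb G (FOb p (Cod E f)))"
  using functor_from_discrete_Arr[OF assms(1) p_mem[OF Cod_Ob[OF f]]] functor_to_discrete(1)[OF p f] f
  by (simp add: comp_functor_def compose_def)

lemma fiber_unit_component:
  assumes x: "x \<in> Ob E"
  shows "content (fiber_unit pt) x \<in> homset (PSh E) (yoneda_ob e E x) (fiber_char pt (FOb p x))"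
proof -
  have "z \<in> Ob (fiber E p (FOb p x))" if "z \<in> Ob E" "FOb (yoneda_ob e E x) z \<noteq> {}" for z
    using that functor_to_discrete(2)[OF p] by (auto simp: FOb_yoneda_ob in_homset_iff)
  then show ?thesis
    using to_char_hom[OF fiber_sieve yoneda_ob_presheaf[OF x]] x
    by (simp add: fiber_unit_def fiber_char_def)
qed

lemma app_fiber_unit:
  assumes "f \<in> homset E z x"
  shows "app (content (fiber_unit pt) x) z (e f) = pt"
  using assms Dom_Ob[of f] Cod_Ob[of f]
  by (auto simp: fiber_unit_def to_char_def in_homset_iff FOb_yoneda_ob)

text \<open>Naturality is automatic, since both composites end in a subterminal presheaf.\<close>

lemma fiber_unit_hom:
  "fiber_unit pt \<in> homset (functor_cat E (PSh E)) (yoneda e E) (comp_functor E (fiber_lan pt) p)"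
proof -
  let ?Lp = "comp_functor E (fiber_lan pt) p"
  have ob: "FOb ?Lp x = fiber_char pt (FOb p x)" if "x \<in> Ob E" for x
    using that by (simp add: comp_functor_p_Ob FOb_fiber_lan p_mem)
  have Lp: "is_functor E (PSh E) ?Lp"
    by (rule is_functor_comp_functor[OF category_axioms p fiber_lan_functor])
  have "Comp (PSh E) (content (fiber_unit pt) (Cod E f)) (FArr (yoneda e E) f) =
      Comp (PSh E) (FArr ?Lp f) (content (fiber_unit pt) (Dom E f))" if f: "f \<in> Arr E" for f
  proof -
    have fh: "f \<in> homset E (Dom E f) (Cod E f)"
      using f by (simp add: in_homset_iff)
    have Lf: "FArr ?Lp f \<in> homset (PSh E) (fiber_char pt (FOb p (Dom E f))) (fiber_char pt (FOb p (Cod E f)))"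
      using functor_homset[OF Lp fh] ob Dom_Ob[OF f] Cod_Ob[OF f] by simp
    show ?thesis
      using char_presheaf_subterminal[of _ _ pt "fiber E p (FOb p (Cod E f))", folded fiber_char_def,
          OF P.Comp_hom[OF yoneda_arr_hom[OF fh] fiber_unit_component[OF Cod_Ob[OF f]]]
            P.Comp_hom[OF fiber_unit_component[OF Dom_Ob[OF f]] Lf]] .
  qed
  moreover have "content (fiber_unit pt) x \<in> homset (PSh E) (FOb (yoneda e E) x) (FOb ?Lp x)"
    if "x \<in> Ob E" for x
    using fiber_unit_component[OF that] ob[OF that] FOb_yoneda[OF that] by simp
  moreover have "src (fiber_unit pt) = yoneda e E" "tgt (fiber_unit pt) = ?Lp"
    "content (fiber_unit pt) \<in> extensional (Ob E)"
    by (simp_all add: fiber_unit_def)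
  ultimately show ?thesis
    using Lp yoneda_functor by (simp add: in_homset_functor_cat is_nat_trans_def)
qed

text \<open>The image of the identity of \<open>z\<close>, which by the Yoneda lemma determines the component of \<open>\<gamma>\<close> at \<open>z\<close>.\<close>

definition universal_section ::
    "('o, 'a, ('o, 'a, 'v) presheaf, ('o, 'a, 'v) presheaf_hom) ntrans \<Rightarrow> 'o \<Rightarrow> 'v" where
  "universal_section \<gamma> z = app (content \<gamma> z) z (e (Id E z))"

context
  fixes G :: "('b, 'b, ('o, 'a, 'v) presheaf, ('o, 'a, 'v) presheaf_hom) funct"
    and \<gamma> :: "('o, 'a, ('o, 'a, 'v) presheaf, ('o, 'a, 'v) presheaf_hom) ntrans"
  assumes G: "is_functor (discrete_cat B) (PSh E) G"
    and \<gamma>: "\<gamma> \<in> homset (functor_cat E (PSh E)) (yoneda e E) (comp_functor E G p)"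
begin

lemma cocone_component:
  "x \<in> Ob E \<Longrightarrow> content \<gamma> x \<in> homset (PSh E) (yoneda_ob e E x) (FOb G (FOb p x))"
  using \<gamma> by (simp add: in_homset_functor_cat is_nat_trans_def FOb_yoneda comp_functor_p_Ob)

text \<open>Naturality of \<open>\<gamma>\<close> along \<open>f\<close> makes its components at \<open>z\<close> and \<open>x\<close> agree up to composition with \<open>f\<close>,
  because \<open>G \<circ> p\<close> sends \<open>f\<close> to an identity. The value of \<open>\<gamma>\<close> on an arrow therefore depends on the
  source of the arrow alone; this is why the colimit over the fiber collapses to a point.\<close>

lemma cocone_eq_section:
  assumes f: "f \<in> homset E z x"
  shows "app (content \<gamma> x) z (e f) = universal_section \<gamma> z"
proof -
  have fA: "f \<in> Arr E" and fe: "Dom E f = z" "Cod E f = x"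
    using f by (simp_all add: in_homset_iff)
  have z: "z \<in> Ob E" and x: "x \<in> Ob E"
    using fA fe Dom_Ob Cod_Ob by auto
  have "FOb p z = FOb p x"
    using functor_to_discrete(2)[OF p fA] fe by simp
  then have "content \<gamma> z = Comp (PSh E) (FArr (comp_functor E G p) f) (content \<gamma> z)"
    using P.Id_Comp[OF cocone_component[OF z]] comp_functor_p_Arr[OF G fA] fe by simp
  also have "\<dots> = Comp (PSh E) (content \<gamma> x) (FArr (yoneda e E) f)"
    using \<gamma> fA fe by (auto simp: in_homset_functor_cat is_nat_trans_def)
  finally have "universal_section \<gamma> z =
      app (Comp (PSh E) (content \<gamma> x) (FArr (yoneda e E) f)) z (e (Id E z))"
    by (simp add: universal_section_def)
  also have "\<dots> = app (content \<gamma> x) z (app (FArr (yoneda e E) f) z (e (Id E z)))"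
    using app_Comp[OF yoneda_arr_hom[OF f] z] Id_hom[OF z] by (simp add: FOb_yoneda_ob z)
  also have "\<dots> = app (content \<gamma> x) z (e f)"
    using app_yoneda[OF f Id_hom[OF z]] Comp_Id[OF f] by simp
  finally show ?thesis ..
qed

lemma section_mem: "x \<in> Ob E \<Longrightarrow> universal_section \<gamma> x \<in> FOb (FOb G (FOb p x)) x"
  using presheaf_hom_mem[OF cocone_component] Id_hom
  by (simp add: universal_section_def FOb_yoneda_ob)

lemma section_compatible:
  assumes f: "f \<in> homset E z x"
  shows "act (FOb G (FOb p x)) f (universal_section \<gamma> x) = universal_section \<gamma> z"
proof -
  have x: "x \<in> Ob E"
    using f Cod_Ob by (auto simp: in_homset_iff)
  have "act (FOb G (FOb p x)) f (universal_section \<gamma> x) =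
      app (content \<gamma> x) z (act (yoneda_ob e E x) f (e (Id E x)))"
    using presheaf_hom_natural[OF cocone_component[OF x] f] Id_hom[OF x]
    by (simp add: universal_section_def FOb_yoneda_ob x)
  also have "\<dots> = universal_section \<gamma> z"
    using act_yoneda_ob[OF f Id_hom[OF x]] Id_Comp[OF f] cocone_eq_section[OF f] by simp
  finally show ?thesis .
qed

text \<open>A map out of the characteristic presheaf of a fiber is a compatible family of elements over that
  fiber, and commuting with the unit forces the family to be \<open>universal_section \<gamma>\<close>.\<close>

lemma fiber_lan_factorization:
  "\<exists>!\<sigma>. \<sigma> \<in> homset (functor_cat (discrete_cat B) (PSh E)) (fiber_lan pt) G \<and>
     Comp (functor_cat E (PSh E)) (whisker E \<sigma> p) (fiber_unit pt) = \<gamma>"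
proof -
  interpret F: category "functor_cat E (PSh E) ::
      (('o, 'a, ('o, 'a, 'v) presheaf, ('o, 'a, 'v) presheaf_hom) funct, _) cat"
    by (rule category_functor_cat[OF category_axioms P.category_axioms])
  define m where "m b = from_char pt E (fiber E p b) (FOb G b) (universal_section \<gamma>)" for b
  define \<sigma> where "\<sigma> = (fiber_lan pt, \<lambda>b \<in> B. m b, G)"
  have GP: "FOb G b \<in> Ob (PSh E)" if "b \<in> B" for b
    using functor_Ob[OF G] that by simp
  have m: "m b \<in> homset (PSh E) (fiber_char pt b) (FOb G b)" if b: "b \<in> B" for b
    unfolding m_def fiber_char_def
  proof (rule from_char_hom[OF fiber_sieve GP[OF b]])
    show "universal_section \<gamma> x \<in> FOb (FOb G b) x" if "x \<in> Ob E" "x \<in> Ob (fiber E p b)" for x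
      using section_mem that by auto
    show "act (FOb G b) f (universal_section \<gamma> (Cod E f)) = universal_section \<gamma> (Dom E f)"
      if "f \<in> Arr E" "Cod E f \<in> Ob (fiber E p b)" for f
      using section_compatible[of f "Dom E f" "Cod E f"] that by (simp add: in_homset_iff)
  qed
  have m_pt: "app (m (FOb p x)) x pt = universal_section \<gamma> x" if "x \<in> Ob E" for x
    using that by (simp add: m_def from_char_def FOb_char)
  have \<sigma>: "\<sigma> \<in> homset (functor_cat (discrete_cat B) (PSh E)) (fiber_lan pt) G"
    unfolding \<sigma>_def
    by (rule discrete_nat_trans[OF P.category_axioms fiber_lan_functor G]) (simp add: FOb_fiber_lan m)
  have component: "content (Comp (functor_cat E (PSh E)) (whisker E \<tau> p) (fiber_unit pt)) x =
      Comp (PSh E) (content \<tau> (FOb p x)) (content (fiber_unit pt) x)" if "x \<in> Ob E"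
    for x and \<tau> :: "('b, 'b, ('o, 'a, 'v) presheaf, ('o, 'a, 'v) presheaf_hom) ntrans"
    using that by (simp add: functor_cat_sel whisker_def)
  have "Comp (functor_cat E (PSh E)) (whisker E \<sigma> p) (fiber_unit pt) = \<gamma>"
  proof (rule functor_cat_hom_eqI[OF F.Comp_hom[OF fiber_unit_hom whisker_homset[OF category_axioms p \<sigma>]] \<gamma>])
    fix x assume x: "x \<in> Ob E"
    note u = fiber_unit_component[OF x, of pt]
    have "Comp (PSh E) (m (FOb p x)) (content (fiber_unit pt) x) = content \<gamma> x"
    proof (rule presheaf_hom_eqI[OF P.Comp_hom[OF u m[OF p_mem[OF x]]] cocone_component[OF x]])
      fix z v assume z: "z \<in> Ob E" and v: "v \<in> FOb (yoneda_ob e E x) z"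
      then obtain f where f: "v = e f" "f \<in> homset E z x"
        by (auto simp: FOb_yoneda_ob)
      have "FOb p z = FOb p x"
        using functor_to_discrete(2)[OF p, of f] f(2) by (auto simp: in_homset_iff)
      then show "app (Comp (PSh E) (m (FOb p x)) (content (fiber_unit pt) x)) z v = app (content \<gamma> x) z v"
        using app_Comp[OF u z v] m_pt[OF z] app_fiber_unit[OF f(2)] cocone_eq_section[OF f(2)] f(1)
        by simp
    qed
    then show "content (Comp (functor_cat E (PSh E)) (whisker E \<sigma> p) (fiber_unit pt)) x = content \<gamma> x"
      using component[OF x] x by (simp add: \<sigma>_def p_mem)
  qed
  moreover have "\<tau> = \<sigma>"
    if \<tau>: "\<tau> \<in> homset (functor_cat (discrete_cat B) (PSh E)) (fiber_lan pt) G"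
      and \<tau>\<gamma>: "Comp (functor_cat E (PSh E)) (whisker E \<tau> p) (fiber_unit pt) = \<gamma>" for \<tau>
  proof (rule functor_cat_hom_eqI[OF \<tau> \<sigma>])
    fix b assume "b \<in> Ob (discrete_cat B)"
    then have b: "b \<in> B"
      by simp
    have \<tau>b: "content \<tau> b \<in> homset (PSh E) (fiber_char pt b) (FOb G b)"
      using \<tau> b by (simp add: in_homset_functor_cat is_nat_trans_def FOb_fiber_lan)
    have "content \<tau> b = m b"
    proof (rule presheaf_hom_eqI[OF \<tau>b m[OF b]])
      fix x v assume x: "x \<in> Ob E" and "v \<in> FOb (fiber_char pt b) x"
      then have v: "v = pt" and xb: "FOb p x = b"
        by (auto simp: FOb_fiber_char split: if_splits)
      \<comment> \<open>evaluate the hypothesis on \<open>\<tau>\<close> at the identity of \<open>x\<close>, which the unit sends to \<open>pt\<close>\<close>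
      have "universal_section \<gamma> x =
          app (Comp (PSh E) (content \<tau> b) (content (fiber_unit pt) x)) x (e (Id E x))"
        using component[OF x, of \<tau>] \<tau>\<gamma> xb by (simp add: universal_section_def)
      also have "\<dots> = app (content \<tau> b) x pt"
        using app_Comp[OF fiber_unit_component[OF x] x] Id_hom[OF x] app_fiber_unit[OF Id_hom[OF x]]
        by (simp add: FOb_yoneda_ob x)
      finally show "app (content \<tau> b) x v = app (m b) x v"
        using m_pt[OF x] xb v by simp
    qed
    then show "content \<tau> b = content \<sigma> b"
      using b by (simp add: \<sigma>_def)
  qed
  ultimately show ?thesis
    using \<sigma> by blast
qed

end

lemma fiber_lan_is_lan:
  "is_lan E (discrete_cat B) (PSh E) p (yoneda e E) (fiber_lan pt) (fiber_unit pt)"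
  unfolding is_lan_def using fiber_lan_functor fiber_unit_hom fiber_lan_factorization by blast

text \<open>\<open>fiber_lan pt\<close> is a left Kan extension for every choice of the point \<open>pt\<close>, and left Kan extensions are
  unique up to isomorphism.\<close>

lemma lan_isomorphic_char:
  assumes A: "is_lan E (discrete_cat B) (PSh E) p (yoneda e E) A \<eta>" and b: "b \<in> B"
  shows "isomorphic (PSh E) (FOb A b) (char_presheaf pt E (fiber E p b))"
proof -
  interpret D: groupoid "discrete_cat B"
    by (rule groupoid_discrete_cat)
  have "isomorphic (functor_cat (discrete_cat B) (PSh E)) A (fiber_lan pt)"
    by (rule lan_unique[OF category_axioms D.category_axioms P.category_axioms p A fiber_lan_is_lan])
  then show ?thesis
    using isomorphic_functor_cat_component[of "discrete_cat B" "PSh E" A "fiber_lan pt" b] b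
    by (simp add: FOb_fiber_lan fiber_char_def)
qed

lemma lan_values:
  assumes A: "is_lan E (discrete_cat B) (PSh E) p (yoneda e E) A \<eta>" and b: "b \<in> B" and x: "x \<in> Ob E"
  shows "FOb (FOb A b) x \<approx> (if FOb p x = b then {()} else {})"
proof -
  have "FOb (FOb A b) x \<approx> (if FOb p x = b then {undefined :: 'v} else {})"
    using isomorphic_PSh_eqpoll[OF lan_isomorphic_char[OF A b] x, of undefined]
    unfolding fiber_char_def[symmetric] FOb_fiber_char[OF x] .
  also have "\<dots> \<approx> (if FOb p x = b then {()} else {})"
    by (simp add: singleton_eqpoll)
  finally show ?thesis .
qed

end

section \<open>Representability\<close>

lemma (in embedded_category) isomorphic_yoneda_imp_hom:
  assumes "isomorphic (PSh E) X (FOb (yoneda e E) x)" "x \<in> Ob E" "z \<in> Ob E" "FOb X z \<noteq> {}"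
  shows "homset E z x \<noteq> {}"
  using isomorphic_PSh_eqpoll[OF assms(1,3)] assms(2-4) eqpoll_empty_iff_empty
  by (auto simp: FOb_yoneda FOb_yoneda_ob)

text \<open>An element of \<open>X\<close> at \<open>z\<close> yields an arrow from \<open>z\<close> to \<open>x\<close>, which is invertible in a groupoid, so \<open>x\<close>
  and \<open>z\<close> represent the same presheaf.\<close>

lemma (in embedded_category) isomorphic_yoneda_transfer:
  assumes gpd: "groupoid E" and X: "isomorphic (PSh E) X (FOb (yoneda e E) x)"
    and x: "x \<in> Ob E" and z: "z \<in> Ob E" and Xz: "FOb X z \<noteq> {}"
  shows "isomorphic (PSh E) X (FOb (yoneda e E) z)"
proof -
  interpret groupoid E by fact
  obtain f where f: "f \<in> homset E z x"
    using isomorphic_yoneda_imp_hom[OF X x z Xz] by blast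
  then have "f \<in> isoset E z x"
    using invertible[of f] by (auto simp: in_homset_iff)
  then have "isomorphic E x z"
    using x z isomorphic_sym unfolding isomorphic_def isoset_def by blast
  then show ?thesis
    using P.isomorphic_trans[OF X functor_isomorphic[OF yoneda_functor]] by blast
qed

section \<open>The category of elements\<close>

lemma elements_cat_sel:
  "Ob (elements_cat E X) = {(x, \<xi>). x \<in> Ob E \<and> \<xi> \<in> FOb X x}"
  "Arr (elements_cat E X) =
     {((x, \<xi>), f, (x', \<xi>')). x \<in> Ob E \<and> \<xi> \<in> FOb X x \<and> x' \<in> Ob E \<and> \<xi>' \<in> FOb X x' \<and>
        f \<in> homset E x x' \<and> act X f \<xi>' = \<xi>}"
  "Dom (elements_cat E X) = src" "Cod (elements_cat E X) = tgt"
  "Id (elements_cat E X) = (\<lambda>s. (s, Id E (fst s), s))"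
  "Comp (elements_cat E X) = (\<lambda>g f. (src f, Comp E (content g) (content f), tgt g))"
  by (simp_all add: elements_cat_def)

text \<open>Over each object of the fiber there is exactly one element, and over all others there is none.
  Hence objects lift uniquely; arrows lift as well, since restriction along an arrow of the fiber can
  only send the one element over its target to the one over its source.\<close>

lemma (in category) iso_functor_elements_proj:
  assumes X: "X \<in> Ob (PSh C)"
    and eqpoll: "\<And>x. x \<in> Ob C \<Longrightarrow> FOb X x \<approx> (if FOb p x = b then {()} else {})"
  shows "iso_functor (elements_cat C X) (fiber C p b) (elements_proj C X)"
proof -
  let ?El = "elements_cat C X" and ?Fi = "fiber C p b" and ?pr = "elements_proj C X"
  have "\<exists>u. FOb X x = (if FOb p x = b then {u} else {})" if "x \<in> Ob C" for x
    using eqpoll[OF that] by (cases "FOb p x = b") (auto simp: eqpoll_singleton_iff)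
  then obtain \<xi> where vals: "\<And>x. x \<in> Ob C \<Longrightarrow> FOb X x = (if FOb p x = b then {\<xi> x} else {})"
    by metis
  \<comment> \<open>the unique lifts of objects and arrows along the projection\<close>
  define lob where "lob x = (x, \<xi> x)" for x
  define larr where "larr f = (lob (Dom C f), f, lob (Cod C f))" for f
  define lift where "lift = \<lparr>FOb = \<lambda>x \<in> Ob ?Fi. lob x, FArr = \<lambda>f \<in> Arr ?Fi. larr f\<rparr>"
  have Ob_El: "Ob ?El = lob ` Ob ?Fi"
    by (auto simp: elements_cat_sel vals lob_def split: if_splits)
  have act_\<xi>: "act X f (\<xi> (Cod C f)) = \<xi> (Dom C f)" if f: "f \<in> Arr ?Fi" for f
  proof -
    have "act X f (\<xi> (Cod C f)) \<in> FOb X (Dom C f)"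
      using presheaf_act_mem[OF X, of f "Dom C f" "Cod C f"] f
      by (auto simp: in_homset_iff vals Cod_Ob)
    then show ?thesis
      using f by (simp add: vals Dom_Ob)
  qed
  have Arr_El: "Arr ?El = larr ` Arr ?Fi"
  proof (intro equalityI subsetI)
    fix t assume "t \<in> Arr ?El"
    then show "t \<in> larr ` Arr ?Fi"
      by (cases t) (auto simp: elements_cat_sel vals in_homset_iff larr_def lob_def split: if_splits)
  next
    fix t assume "t \<in> larr ` Arr ?Fi"
    then show "t \<in> Arr ?El"
      using act_\<xi> by (auto simp: elements_cat_sel vals in_homset_iff larr_def lob_def Dom_Ob Cod_Ob)
  qed
  have Id_Fi: "Id C x \<in> Arr ?Fi" "Dom C (Id C x) = x" "Cod C (Id C x) = x" if "x \<in> Ob ?Fi" for x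
    using Id_hom[of x] that by (auto simp: in_homset_iff)
  have Comp_Fi: "Comp C g f \<in> Arr ?Fi" "Dom C (Comp C g f) = Dom C f" "Cod C (Comp C g f) = Cod C g"
    if "f \<in> Arr ?Fi" "g \<in> Arr ?Fi" "Cod C f = Dom C g" for f g
    using Comp_hom[of f "Dom C f" "Cod C f" g "Cod C g"] that by (auto simp: in_homset_iff)
  have Id_El: "Id ?El (lob x) = larr (Id C x)" if "x \<in> Ob ?Fi" for x
    using Id_Fi[OF that] by (simp add: elements_cat_sel larr_def lob_def)
  have Comp_El: "Comp ?El (larr g) (larr f) = larr (Comp C g f)"
    if "f \<in> Arr ?Fi" "g \<in> Arr ?Fi" "Cod C f = Dom C g" for f g
    using Comp_Fi[OF that] by (simp add: elements_cat_sel larr_def)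
  have End_El: "Dom ?El (larr f) = lob (Dom C f)" "Cod ?El (larr f) = lob (Cod C f)" for f
    by (simp_all add: elements_cat_sel larr_def)
  have lob_inj: "lob x = lob y \<longleftrightarrow> x = y" for x y
    by (auto simp: lob_def)
  have pr_Ob: "FOb ?pr (lob x) = x" if "x \<in> Ob ?Fi" for x
    using that Ob_El by (auto simp: elements_proj_def lob_def)
  have pr_Arr: "FArr ?pr (larr f) = f" if "f \<in> Arr ?Fi" for f
    using that Arr_El by (auto simp: elements_proj_def larr_def)
  have pr_ext: "FOb ?pr \<in> extensional (Ob ?El)" "FArr ?pr \<in> extensional (Arr ?El)"
    by (simp_all add: elements_proj_def)
  have ends_Fi: "Dom C f \<in> Ob ?Fi" "Cod C f \<in> Ob ?Fi" if "f \<in> Arr ?Fi" for f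
    using that Dom_Ob Cod_Ob by auto
  have lift_sel: "x \<in> Ob ?Fi \<Longrightarrow> FOb lift x = lob x" "f \<in> Arr ?Fi \<Longrightarrow> FArr lift f = larr f" for x f
    by (simp_all add: lift_def)
  have "is_functor ?El ?Fi ?pr"
    unfolding is_functor_def Ob_El Arr_El PiE_iff
    using pr_ext[unfolded Ob_El Arr_El]
    by (auto simp del: fiber_sel(1,2) simp: pr_Ob pr_Arr End_El ends_Fi Id_Fi Comp_Fi Id_El Comp_El
        lob_inj in_homset_iff)
  moreover have "is_functor ?Fi ?El lift"
    unfolding is_functor_def Ob_El Arr_El PiE_iff in_homset_iff
    by (auto simp del: fiber_sel(1,2) simp: lift_sel End_El ends_Fi Id_Fi Comp_Fi Id_El Comp_El)
      (simp_all add: lift_def)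
  moreover have "comp_functor ?El lift ?pr = id_functor ?El" "comp_functor ?Fi ?pr lift = id_functor ?Fi"
    unfolding comp_functor_def id_functor_def compose_def Ob_El Arr_El
    by (auto simp del: fiber_sel(1,2) simp: lift_sel pr_Ob pr_Arr intro!: restrict_ext)
  ultimately show ?thesis
    unfolding iso_functor_def by blast
qed

section \<open>The aggregate of a fiber\<close>

text \<open>A fiber whose aggregate is not representable: two objects with no arrow between them.
  The aggregate has an element at both objects, whereas a presheaf represented by one of them is empty
  at the other.\<close>

definition two_points :: "(nat, nat) cat" where
  "two_points = discrete_cat {0, 1}"

definition collapse :: "(nat, nat, nat, nat) funct" where
  "collapse = \<lparr>FOb = \<lambda>x \<in> {0, 1}. 0, FArr = \<lambda>x \<in> {0, 1}. 0\<rparr>"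

lemma collapse_functor: "is_functor two_points (discrete_cat {0}) collapse"
  by (auto simp: is_functor_def two_points_def collapse_def in_homset_iff)

lemma collapse_lan_not_representable:
  assumes A: "is_lan two_points (discrete_cat {0}) (PSh two_points) collapse (yoneda (\<lambda>a. a) two_points) A \<eta>"
  shows "\<not> representable (\<lambda>a. a) two_points (FOb A 0)"
proof
  interpret T: groupoid two_points
    unfolding two_points_def by (rule groupoid_discrete_cat)
  interpret fibered_category two_points "\<lambda>a. a" "{0}" collapse
    by unfold_locales (auto simp: collapse_functor)
  assume "representable (\<lambda>a. a) two_points (FOb A 0)"
  then obtain x where x: "x \<in> Ob two_points"
    and iso: "isomorphic (PSh two_points) (FOb A 0) (FOb (yoneda (\<lambda>a. a) two_points) x)"
    by (auto simp: representable_def)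
  \<comment> \<open>truncated subtraction exchanges the two objects \<open>0\<close> and \<open>1\<close>\<close>
  have z: "1 - x \<in> Ob two_points" "1 - x \<noteq> x"
    using x by (auto simp: two_points_def)
  then have "FOb (FOb A 0) (1 - x) \<approx> {()}"
    using lan_values[OF A, of 0 "1 - x"] by (auto simp: two_points_def collapse_def)
  then have "FOb (FOb A 0) (1 - x) \<noteq> {}"
    by (auto simp: eqpoll_singleton_iff)
  then have "homset two_points (1 - x) x \<noteq> {}"
    by (rule isomorphic_yoneda_imp_hom[OF iso x z(1)])
  then show False
    using z(2) by (auto simp: two_points_def in_homset_iff)
qed

theorem theorem15p1:
  fixes E :: "('o, 'a) cat" and B :: "'b set" and p :: "('o, 'a, 'b, 'b) funct"
    and e :: "'a \<Rightarrow> 'v"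
  assumes "groupoid E"
    and "is_functor E (discrete_cat B) p"
    and "inj_on e (Arr E)"
  shows "(\<exists>A \<eta>. is_lan E (discrete_cat B) (PSh E) p (yoneda e E) A \<eta>) \<and>
    (\<forall>A \<eta>. is_lan E (discrete_cat B) (PSh E) p (yoneda e E) A \<eta> \<longrightarrow>
      (\<forall>b \<in> B.
        (\<forall>x \<in> Ob E. FOb (FOb A b) x \<approx> (if FOb p x = b then {()} else {})) \<and>
        (\<forall>pt. isomorphic (PSh E) (FOb A b) (char_presheaf pt E (fiber E p b))) \<and>
        (\<forall>x \<in> Ob (fiber E p b). \<forall>x' \<in> Ob (fiber E p b).
           isomorphic (PSh E) (FOb A b) (FOb (yoneda e E) x) \<longleftrightarrow>
           isomorphic (PSh E) (FOb A b) (FOb (yoneda e E) x')) \<and>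
        iso_functor (elements_cat E (FOb A b)) (fiber E p b) (elements_proj E (FOb A b)) \<and>
        bij_betw (FOb (elements_proj E (FOb A b)))
          (Ob (elements_cat E (FOb A b))) (Ob (fiber E p b)) \<and>
        (\<forall>s \<in> Ob (elements_cat E (FOb A b)).
           FArr (elements_proj E (FOb A b)) \<in>
             iso (aut_group (elements_cat E (FOb A b)) s)
                 (aut_group (fiber E p b) (FOb (elements_proj E (FOb A b)) s))))) \<and>
    (\<exists>(E' :: (nat, nat) cat) (B' :: nat set) p' b.
      groupoid E' \<and> is_functor E' (discrete_cat B') p' \<and> b \<in> B' \<and>
      (\<exists>x \<in> Ob (fiber E' p' b). \<exists>x' \<in> Ob (fiber E' p' b). x \<noteq> x') \<and>
      (\<forall>A \<eta>. is_lan E' (discrete_cat B') (PSh E') p' (yoneda (\<lambda>a :: nat. a) E') A \<eta> \<longrightarrow>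
         \<not> representable (\<lambda>a. a) E' (FOb A b) \<and>
         \<not> (\<exists>x \<in> Ob (fiber E' p' b). isomorphic (PSh E') (FOb A b) (FOb (yoneda (\<lambda>a. a) E') x))))"
proof -
  interpret groupoid E by fact
  interpret fibered_category E e B p
    by unfold_locales (use assms in auto)
  have exists: "\<exists>A \<eta>. is_lan E (discrete_cat B) (PSh E) p (yoneda e E) A \<eta>"
    using fiber_lan_is_lan by blast
  have yoneda_iff: "isomorphic (PSh E) (FOb A b) (FOb (yoneda e E) x) \<longleftrightarrow>
      isomorphic (PSh E) (FOb A b) (FOb (yoneda e E) x')"
    if A: "is_lan E (discrete_cat B) (PSh E) p (yoneda e E) A \<eta>" and b: "b \<in> B"
      and x: "x \<in> Ob (fiber E p b)" and x': "x' \<in> Ob (fiber E p b)" for A \<eta> b x x'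
  proof -
    have "FOb (FOb A b) z \<noteq> {}" if "z \<in> Ob (fiber E p b)" for z
      using lan_values[OF A b, of z] that by (auto simp: eqpoll_singleton_iff)
    then show ?thesis
      using isomorphic_yoneda_transfer[OF assms(1), of "FOb A b"] x x' by auto
  qed
  have elements: "iso_functor (elements_cat E (FOb A b)) (fiber E p b) (elements_proj E (FOb A b))"
    if A: "is_lan E (discrete_cat B) (PSh E) p (yoneda e E) A \<eta>" and b: "b \<in> B" for A \<eta> b
  proof (rule iso_functor_elements_proj)
    show "FOb A b \<in> Ob (PSh E)"
      using functor_Ob[of "discrete_cat B" "PSh E" A b] A b by (simp add: is_lan_def)
  qed (rule lan_values[OF A b])
  have points: "0 \<in> Ob (fiber two_points collapse 0)" "1 \<in> Ob (fiber two_points collapse 0)"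
    by (simp_all add: two_points_def collapse_def)
  have nonrep: "\<exists>(E' :: (nat, nat) cat) (B' :: nat set) p' b.
      groupoid E' \<and> is_functor E' (discrete_cat B') p' \<and> b \<in> B' \<and>
      (\<exists>x \<in> Ob (fiber E' p' b). \<exists>x' \<in> Ob (fiber E' p' b). x \<noteq> x') \<and>
      (\<forall>A \<eta>. is_lan E' (discrete_cat B') (PSh E') p' (yoneda (\<lambda>a :: nat. a) E') A \<eta> \<longrightarrow>
         \<not> representable (\<lambda>a. a) E' (FOb A b) \<and>
         \<not> (\<exists>x \<in> Ob (fiber E' p' b). isomorphic (PSh E') (FOb A b) (FOb (yoneda (\<lambda>a. a) E') x)))"
  proof (intro exI conjI allI impI)
    show "groupoid two_points"
      unfolding two_points_def by (rule groupoid_discrete_cat)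
    show "is_functor two_points (discrete_cat {0}) collapse"
      by (rule collapse_functor)
    show "0 \<in> {0 :: nat}"
      by simp
    show "\<exists>x \<in> Ob (fiber two_points collapse 0). \<exists>x' \<in> Ob (fiber two_points collapse 0). x \<noteq> x'"
      using points by (metis zero_neq_one)
    fix A \<eta>
    assume A: "is_lan two_points (discrete_cat {0}) (PSh two_points) collapse
      (yoneda (\<lambda>a. a) two_points) A \<eta>"
    show "\<not> representable (\<lambda>a. a) two_points (FOb A 0)"
      by (rule collapse_lan_not_representable[OF A])
    then show "\<not> (\<exists>x \<in> Ob (fiber two_points collapse 0).
        isomorphic (PSh two_points) (FOb A 0) (FOb (yoneda (\<lambda>a. a) two_points) x))"
      by (auto simp: representable_def)
  qed
  show ?thesis
  proof (intro conjI allI impI ballI)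
    fix A \<eta> b
    assume A: "is_lan E (discrete_cat B) (PSh E) p (yoneda e E) A \<eta>" and b: "b \<in> B"
    show "FOb (FOb A b) x \<approx> (if FOb p x = b then {()} else {})" if "x \<in> Ob E" for x
      by (rule lan_values[OF A b that])
    show "isomorphic (PSh E) (FOb A b) (char_presheaf pt E (fiber E p b))" for pt
      by (rule lan_isomorphic_char[OF A b])
    show "isomorphic (PSh E) (FOb A b) (FOb (yoneda e E) x) \<longleftrightarrow>
        isomorphic (PSh E) (FOb A b) (FOb (yoneda e E) x')"
      if "x \<in> Ob (fiber E p b)" "x' \<in> Ob (fiber E p b)" for x x'
      by (rule yoneda_iff[OF A b that])
    show "iso_functor (elements_cat E (FOb A b)) (fiber E p b) (elements_proj E (FOb A b))"
      by (rule elements[OF A b])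
    then show "bij_betw (FOb (elements_proj E (FOb A b)))
        (Ob (elements_cat E (FOb A b))) (Ob (fiber E p b))"
      by (rule iso_functor_bij_betw_Ob)
    show "FArr (elements_proj E (FOb A b)) \<in>
        iso (aut_group (elements_cat E (FOb A b)) s)
            (aut_group (fiber E p b) (FOb (elements_proj E (FOb A b)) s))"
      if "s \<in> Ob (elements_cat E (FOb A b))" for s
      by (rule iso_functor_iso_aut_group[OF elements[OF A b] that])
  qed (rule exists nonrep)+
qed

end
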